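(* Let $\mathfrak{w},\mathfrak{q}$ be real with $|\mathfrak{w}|>\sqrt{\mathfrak{q}^2+1}$. The upper sign below refers to $\mathfrak{w}>\sqrt{\mathfrak{q}^2+1}$ and the lower sign to $\mathfrak{w}<-\sqrt{\mathfrak{q}^2+1}$. For positive frequency, consider the scattering solution describing radiation that enters from spatial infinity ($v\to-\infty$) and is partially reflected and partially transmitted into the black hole horizon ($v\to+\infty$): $$e^{i\mathfrak{w}v/2}\ \ (v\to+\infty),\qquad A^+_{\rm in}\,e^{i\sqrt{\mathfrak{w}^2-\mathfrak{q}^2-1}\,v/2}+A^+_{\rm out}\,e^{-i\sqrt{\mathfrak{w}^2-\mathfrak{q}^2-1}\,v/2}\ \ (v\to-\infty),$$ where $A^+_{\rm in}=C_{00}$ and $A^+_{\rm out}=C_{01}$. For negative frequency, consider the solution describing the time reversal of the absorption process: $$e^{-i\mathfrak{w}v/2}\ \ (v\to+\infty),\qquad A^-_{\rm out}\,e^{i\sqrt{\mathfrak{w}^2-\mathfrak{q}^2-1}\,v/2}+A^-_{\rm in}\,e^{-i\sqrt{\mathfrak{w}^2-\mathfrak{q}^2-1}\,v/2}\ \ (v\to-\infty),$$ where $A^-_{\rm in}=C_{11}$ and $A^-_{\rm out}=C_{10}$. Here the $C_{ij}$ are the connection coefficients of the hypergeometric equation given in the context. Then the reflection and transmission coefficients, defined by comparing the probability current $J=-i(\psi^*\partial_v\psi-{\rm c.c.})$ at spatial infinity and at the horizon, are the same for scalar and shear perturbations, and are given by $$\mathcal{R}^\pm=\frac{|A^\pm_{\rm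 out}|^2}{|A^\pm_{\rm in}|^2}=\frac{\cosh^2\left[\frac{\pi}{2}\left(\sqrt{\mathfrak{w}^2-\mathfrak{q}^2-1}\mp\mathfrak{w}\right)\right]}{\cosh^2\left[\frac{\pi}{2}\left(\sqrt{\mathfrak{w}^2-\mathfrak{q}^2-1}\pm\mathfrak{w}\right)\right]},$$ $$\mathcal{T}^\pm=\frac{\pm\mathfrak{w}}{\sqrt{\mathfrak{w}^2-\mathfrak{q}^2-1}\;|A^\pm_{\rm in}|^2}=1-\mathcal{R}^\pm=\frac{\pm\sinh(\pi\mathfrak{w})\,\sinh\left(\pi\sqrt{\mathfrak{w}^2-\mathfrak{q}^2-1}\right)}{\cosh^2\left[\frac{\pi}{2}\left(\sqrt{\mathfrak{w}^2-\mathfrak{q}^2-1}\pm\mathfrak{w}\right)\right]}.$$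
   Context: The setting is small fluctuations, with time dependence $e^{-i\omega t}$ and spatial momentum $q$, of a planar linear dilaton black hole at the Hagedorn temperature $T_H$, with $\mathfrak{w}=\omega/(2\pi T_H)$ and $\mathfrak{q}=q/(2\pi T_H)$. The radial variable is $u\in(0,1)$, with $u\to0$ spatial infinity and $u\to1$ the horizon. The tortoise coordinate is $v=\log u-\log(1-u)$. Primes denote $d/du$. Scalar (dilaton or tensor) perturbation: $Z''-\frac{1}{1-u}Z'+\frac{\mathfrak{w}^2-(1-u)\mathfrak{q}^2}{4u^2(1-u)^2}Z=0$. Setting $Z=\sqrt{u}\,\psi$ gives $(-\partial_v^2+V)\psi=\frac{\mathfrak{w}^2}{4}\psi$ with $V=\frac{1-u^2+\mathfrak{q}^2(1-u)}{4}$. Setting $Z=u^{c/2}(1-u)^{-i\mathfrak{w}/2}y$ gives the hypergeometric equation $u(1-u)y''+(c-(a+b+1)u)y'-ab\,y=0$ with $c=1+s$, $a=b=\frac{1+s-i\mathfrak{w}}{2}$, where $s=\sqrt{1+\mathfrak{q}^2-\mathfrak{w}^2}$. Shear perturbation: the metric components $H_{tx},H_{zx}$ satisfy $\mathfrak{w}H_{tx}'+\mathfrak{q}(1-u)H_{zx}'=0$, $H_{zx}''-\frac{H_{zx}'}{1-u}+\frac{\mathfrak{q}\mathfrak{w}H_{tx}+\mathfrak{w}^2H_{zx}}{4(1-u)^2u^2}=0$ and $H_{tx}''-\frac{\mathfrak{q}^2H_{tx}+\mathfrak{q}\mathfrak{w}H_{zx}}{4(1-u)u^2}=0$. The resulting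 equation for $H_{tx}'$ (or $H_{zx}'$) reduces to a hypergeometric equation with $c=1+s$, $a=\frac{-1+s-i\mathfrak{w}}{2}$, $b=\frac{3+s-i\mathfrak{w}}{2}$. The shear amplitudes are the connection coefficients with these parameters. Connection coefficients: let $y_0^{(0)}={}_2F_1(a,b,c;u)$, $y_0^{(1)}=u^{1-c}{}_2F_1(a+1-c,b+1-c,2-c;u)$, $y_1^{(0)}={}_2F_1(a,b,1-c+a+b;1-u)$, $y_1^{(1)}=(1-u)^{c-a-b}{}_2F_1(c-a,c-b,1+c-a-b;1-u)$. Then $y_1^{(i)}=C_{i0}\,y_0^{(0)}+C_{i1}\,y_0^{(1)}$ for $i=0,1$, with $$C_{00}=\frac{\Gamma(1-c+a+b)\Gamma(1-c)}{\Gamma(1-c+b)\Gamma(1-c+a)},\qquad C_{01}=\frac{\Gamma(1-c+a+b)\Gamma(c-1)}{\Gamma(a)\Gamma(b)},$$ $$C_{10}=\frac{\Gamma(1+c-a-b)\Gamma(1-c)}{\Gamma(1-a)\Gamma(1-b)},\qquad C_{11}=\frac{\Gamma(1+c-a-b)\Gamma(c-1)}{\Gamma(c-b)\Gamma(c-a)}.$$ In the scattering amplitudes the square root is evaluated as $s=i\sqrt{\mathfrak{w}^2-\mathfrak{q}^2-1}$, so that $C_{00}$ and $C_{10}$ multiply $e^{i\sqrt{\mathfrak{w}^2-\mathfrak{q}^2-1}\,v/2}$ and $C_{01}$ and $C_{11}$ multiply $e^{-i\sqrt{\mathfrak{w}^2-\mathfrak{q}^2-1}\,v/2}$.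
   Formalization: For negative frequency, the printed amplitude expressions are the inverse of the closed form (they give R>1), so A_in and A_out are exchanged there: R^- = |A_in|²/|A_out|² and T^- = -w/(sqrt(w²-q²-1)|A_out|²), with currents compared to the A_out wave; all closed forms are kept. *)

theory Defs
  imports "HOL-Analysis.Analysis"
begin

section \<open>Perturbation equations\<close>

text \<open>
  The radial variable \<open>u\<close> ranges over \<open>{0<..<1}\<close>; \<open>u \<rightarrow> 0\<close> is spatial infinity and \<open>u \<rightarrow> 1\<close> the
  horizon. \<open>w\<close> and \<open>q\<close> are the dimensionless frequency and momentum.
\<close>

definition tortoise :: "real \<Rightarrow> real" where
  "tortoise u = ln u - ln (1 - u)"

definition scalar_perturbation :: "real \<Rightarrow> real \<Rightarrow> (real \<Rightarrow> complex) \<Rightarrow> bool" where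
  "scalar_perturbation w q Z \<longleftrightarrow>
    (\<exists>Z' Z''. \<forall>u\<in>{0<..<1}.
      (Z has_vector_derivative Z' u) (at u) \<and>
      (Z' has_vector_derivative Z'' u) (at u) \<and>
      Z'' u - Z' u / of_real (1 - u)
        + of_real ((w\<^sup>2 - (1 - u) * q\<^sup>2) / (4 * u\<^sup>2 * (1 - u)\<^sup>2)) * Z u = 0)"

definition shear_perturbation ::
    "real \<Rightarrow> real \<Rightarrow> (real \<Rightarrow> complex) \<Rightarrow> (real \<Rightarrow> complex) \<Rightarrow> bool" where
  "shear_perturbation w q Htx Hzx \<longleftrightarrow>
    (\<exists>Htx' Htx'' Hzx' Hzx''. \<forall>u\<in>{0<..<1}.
      (Htx has_vector_derivative Htx' u) (at u) \<and>
      (Htx' has_vector_derivative Htx'' u) (at u) \<and>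
      (Hzx has_vector_derivative Hzx' u) (at u) \<and>
      (Hzx' has_vector_derivative Hzx'' u) (at u) \<and>
      of_real w * Htx' u + of_real (q * (1 - u)) * Hzx' u = 0 \<and>
      Hzx'' u - Hzx' u / of_real (1 - u)
        + (of_real (q * w) * Htx u + of_real (w\<^sup>2) * Hzx u)
            / of_real (4 * (1 - u)\<^sup>2 * u\<^sup>2) = 0 \<and>
      Htx'' u - (of_real (q\<^sup>2) * Htx u + of_real (q * w) * Hzx u)
            / of_real (4 * (1 - u) * u\<^sup>2) = 0)"

datatype sector = Scalar | Shear

text \<open>
  \<open>mode X w q \<psi>\<close>: \<open>\<psi>\<close>, as a function of the tortoise coordinate, is the wave function of a
  perturbation. For the scalar \<open>Z = sqrt u * \<psi>\<close>. In the shear sector both \<open>H\<^sub>t\<^sub>x'\<close> and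
  \<open>(1 - u) * H\<^sub>z\<^sub>x'\<close> (proportional to each other by the first shear equation) have the form
  \<open>u powr ((s - 1) / 2) * (1 - u) powr (- \<i> * w / 2) * y\<close> with \<open>y\<close> hypergeometric, so multiplying
  by \<open>sqrt u\<close> removes the non-oscillating prefactor; the resulting \<open>\<psi>\<close> satisfies
  \<open>- \<psi>'' + V * \<psi> = (w\<^sup>2 / 4) * \<psi>\<close> with real \<open>V = (q\<^sup>2 * (1 - u) + (1 - u) * (1 - 3 * u)) / 4\<close>.
  The form with \<open>H\<^sub>z\<^sub>x'\<close> is the one that stays nontrivial at \<open>q = 0\<close>.
\<close>

fun mode :: "sector \<Rightarrow> real \<Rightarrow> real \<Rightarrow> (real \<Rightarrow> complex) \<Rightarrow> bool" where
  "mode Scalar w q \<psi> \<longleftrightarrow>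
    (\<exists>Z. scalar_perturbation w q Z \<and>
      (\<forall>u\<in>{0<..<1}. Z u = of_real (sqrt u) * \<psi> (tortoise u)))"
| "mode Shear w q \<psi> \<longleftrightarrow>
    (\<exists>Htx Hzx. shear_perturbation w q Htx Hzx \<and>
      ((\<forall>u\<in>{0<..<1}. \<psi> (tortoise u) = of_real (sqrt u) * vector_derivative Htx (at u)) \<or>
       (\<forall>u\<in>{0<..<1}. \<psi> (tortoise u) =
          of_real (sqrt u * (1 - u)) * vector_derivative Hzx (at u))))"


section \<open>Connection coefficients\<close>

definition conn_00 :: "complex \<Rightarrow> complex \<Rightarrow> complex \<Rightarrow> complex" where
  "conn_00 a b c = Gamma (1 - c + a + b) * Gamma (1 - c) / (Gamma (1 - c + b) * Gamma (1 - c + a))"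

definition conn_01 :: "complex \<Rightarrow> complex \<Rightarrow> complex \<Rightarrow> complex" where
  "conn_01 a b c = Gamma (1 - c + a + b) * Gamma (c - 1) / (Gamma a * Gamma b)"

definition conn_10 :: "complex \<Rightarrow> complex \<Rightarrow> complex \<Rightarrow> complex" where
  "conn_10 a b c = Gamma (1 + c - a - b) * Gamma (1 - c) / (Gamma (1 - a) * Gamma (1 - b))"

definition conn_11 :: "complex \<Rightarrow> complex \<Rightarrow> complex \<Rightarrow> complex" where
  "conn_11 a b c = Gamma (1 + c - a - b) * Gamma (c - 1) / (Gamma (c - b) * Gamma (c - a))"

definition wavenumber :: "real \<Rightarrow> real \<Rightarrow> real" where
  "wavenumber w q = sqrt (w\<^sup>2 - q\<^sup>2 - 1)"

text \<open>The branch of \<open>s = sqrt (1 + q\<^sup>2 - w\<^sup>2)\<close> used in the scattering amplitudes, for either sign of \<open>w\<close>.\<close>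

definition hyp_s :: "real \<Rightarrow> real \<Rightarrow> complex" where
  "hyp_s w q = \<i> * of_real (wavenumber w q)"

definition hyp_c :: "real \<Rightarrow> real \<Rightarrow> complex" where
  "hyp_c w q = 1 + hyp_s w q"

fun hyp_a :: "sector \<Rightarrow> real \<Rightarrow> real \<Rightarrow> complex" where
  "hyp_a Scalar w q = (1 + hyp_s w q - \<i> * of_real w) / 2"
| "hyp_a Shear w q = (- 1 + hyp_s w q - \<i> * of_real w) / 2"

fun hyp_b :: "sector \<Rightarrow> real \<Rightarrow> real \<Rightarrow> complex" where
  "hyp_b Scalar w q = (1 + hyp_s w q - \<i> * of_real w) / 2"
| "hyp_b Shear w q = (3 + hyp_s w q - \<i> * of_real w) / 2"

definition C00 :: "sector \<Rightarrow> real \<Rightarrow> real \<Rightarrow> complex" where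
  "C00 X w q = conn_00 (hyp_a X w q) (hyp_b X w q) (hyp_c w q)"

definition C01 :: "sector \<Rightarrow> real \<Rightarrow> real \<Rightarrow> complex" where
  "C01 X w q = conn_01 (hyp_a X w q) (hyp_b X w q) (hyp_c w q)"

definition C10 :: "sector \<Rightarrow> real \<Rightarrow> real \<Rightarrow> complex" where
  "C10 X w q = conn_10 (hyp_a X w q) (hyp_b X w q) (hyp_c w q)"

definition C11 :: "sector \<Rightarrow> real \<Rightarrow> real \<Rightarrow> complex" where
  "C11 X w q = conn_11 (hyp_a X w q) (hyp_b X w q) (hyp_c w q)"


section \<open>Scattering solutions\<close>

definition plane_wave :: "complex \<Rightarrow> real \<Rightarrow> real \<Rightarrow> complex" where
  "plane_wave A p v = A * exp (\<i> * of_real (p * v / 2))"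

definition absorption_solution ::
    "sector \<Rightarrow> real \<Rightarrow> real \<Rightarrow> (real \<Rightarrow> complex) \<Rightarrow> complex \<Rightarrow> complex \<Rightarrow> bool" where
  "absorption_solution X w q \<psi> A_in A_out \<longleftrightarrow>
    mode X w q \<psi> \<and>
    ((\<lambda>v. \<psi> v - plane_wave 1 w v) \<longlongrightarrow> 0) at_top \<and>
    ((\<lambda>v. \<psi> v - (plane_wave A_in (wavenumber w q) v + plane_wave A_out (- wavenumber w q) v))
       \<longlongrightarrow> 0) at_bot"

definition reversed_absorption_solution ::
    "sector \<Rightarrow> real \<Rightarrow> real \<Rightarrow> (real \<Rightarrow> complex) \<Rightarrow> complex \<Rightarrow> complex \<Rightarrow> bool" where
  "reversed_absorption_solution X w q \<psi> A_in A_out \<longleftrightarrow>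
    mode X w q \<psi> \<and>
    ((\<lambda>v. \<psi> v - plane_wave 1 (- w) v) \<longlongrightarrow> 0) at_top \<and>
    ((\<lambda>v. \<psi> v - (plane_wave A_out (wavenumber w q) v + plane_wave A_in (- wavenumber w q) v))
       \<longlongrightarrow> 0) at_bot"


section \<open>Reflection and transmission coefficients\<close>

text \<open>\<open>Re\<close> only changes the type: the expression is real.\<close>

definition current :: "(real \<Rightarrow> complex) \<Rightarrow> real \<Rightarrow> real" where
  "current f v = Re (- \<i> * (cnj (f v) * vector_derivative f (at v)
                              - cnj (cnj (f v) * vector_derivative f (at v))))"

definition current_at_infinity :: "(real \<Rightarrow> complex) \<Rightarrow> real" where
  "current_at_infinity f = Lim at_bot (current f)"

definition current_at_horizon :: "(real \<Rightarrow> complex) \<Rightarrow> real" where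
  "current_at_horizon f = Lim at_top (current f)"

text \<open>
  Both currents are compared with that of the wave \<open>f\<close> at spatial infinity whose current is positive,
  i.e. \<open>f v = A * exp (\<i> * k * v / 2)\<close> with \<open>k = wavenumber w q > 0\<close>; \<open>g\<close> is the wave with negative
  current. For \<open>w > 0\<close>, \<open>f\<close> is the incoming and \<open>g\<close> the outgoing wave. For the time-reversed process
  with \<open>w < 0\<close> the phase \<open>exp (- \<i> * \<omega> * t)\<close> makes \<open>f\<close> the outgoing and \<open>g\<close> the incoming wave, so there
  these are the coefficients of the absorption process whose time reversal is considered. The opposite
  choice for \<open>w < 0\<close> would give a reflection coefficient exceeding 1.
\<close>

definition reflection_coefficient :: "(real \<Rightarrow> complex) \<Rightarrow> (real \<Rightarrow> complex) \<Rightarrow> real" where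
  "reflection_coefficient f g = - current_at_infinity g / current_at_infinity f"

definition transmission_coefficient :: "(real \<Rightarrow> complex) \<Rightarrow> (real \<Rightarrow> complex) \<Rightarrow> real" where
  "transmission_coefficient f \<psi> = current_at_horizon \<psi> / current_at_infinity f"

end

theory Submission
  imports Defs
begin

text \<open>
  In the tortoise coordinate both sectors become a Schroedinger equation with a real potential that
  depends on the wavenumber \<open>k\<close> only through \<open>k\<^sup>2\<close>. The hypergeometric series around the horizon
  gives a solution \<open>\<psi>\<^sub>k\<close> asymptotic to \<open>exp (\<i> * w * v / 2)\<close> there. Comparing its coefficients with
  those of the binomial series of \<open>(1 - x) powr (- \<i> * k)\<close> yields the amplitude of
  \<open>exp (- \<i> * k * v / 2)\<close> at spatial infinity. A Wronskian argument shows that a solution is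
  determined by its asymptotics at the horizon, so \<open>\<psi>\<^sub>k = \<psi>\<^sub>-\<^sub>k\<close>, and the same comparison for \<open>- k\<close>
  yields the other amplitude; this replaces the connection formula and Euler's transformation.
  The moduli follow from the reflection formula of the Gamma function, and the time-reversed process
  is the absorption process with \<open>w\<close> replaced by \<open>- w\<close>.
\<close>

section \<open>The hypergeometric series\<close>

text \<open>Hence the subtraction of an exactly summable series with the same leading coefficients.
  It pins down only the oscillating part; the constant part is at first an unidentified limit, and
  changing the sign of \<open>k\<close> supplies it, because that change swaps the two roles. The
  scattering conditions speak of values and not of derivatives, and the currents at infinity are
  those of exact plane waves. So derivative asymptotics are required at the horizon alone, where the
  Wronskian and the transmitted current are evaluated. For the same reason uniqueness has to start
  from a difference of solutions that tends to 0 with nothing known of its derivative; expanding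
  that difference in a solution and its conjugate achieves this.\<close>

definition hypergeo_coeff :: "complex \<Rightarrow> complex \<Rightarrow> complex \<Rightarrow> nat \<Rightarrow> complex" where
  "hypergeo_coeff a b c n = pochhammer a n * pochhammer b n / (pochhammer c n * fact n)"

definition hypergeo :: "complex \<Rightarrow> complex \<Rightarrow> complex \<Rightarrow> complex \<Rightarrow> complex" where
  "hypergeo a b c z = (\<Sum>n. hypergeo_coeff a b c n * z ^ n)"

text \<open>In the quotient of four \<open>rGamma_series\<close> the factorials cancel, and the
  powers of n cancel because the upper and lower parameters have the same sum. The index shift at
  the end reflects that \<open>rGamma_series z n\<close> contains
  \<open>pochhammer z (Suc n)\<close>.\<close>

lemma pochhammer_ratio_limit:
  fixes a b c d :: complex
  assumes "a + b = c + d" "c \<notin> \<int>\<^sub>\<le>\<^sub>0" "d \<notin> \<int>\<^sub>\<le>\<^sub>0"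
  shows "(\<lambda>n. pochhammer a n * pochhammer b n / (pochhammer c n * pochhammer d n))
           \<longlonglongrightarrow> Gamma c * Gamma d / (Gamma a * Gamma b)"
proof -
  have exps: "exp (a * l) * exp (b * l) = exp (c * l) * exp (d * l)" for l
    using assms(1) by (simp flip: exp_add distrib_right)
  have "(\<lambda>n. rGamma_series a n * rGamma_series b n / (rGamma_series c n * rGamma_series d n))
      \<longlonglongrightarrow> rGamma a * rGamma b / (rGamma c * rGamma d)"
    using assms by (intro tendsto_intros rGamma_series_LIMSEQ) (auto simp: rGamma_eq_zero_iff)
  moreover have "rGamma_series a n * rGamma_series b n / (rGamma_series c n * rGamma_series d n)
      = pochhammer a (Suc n) * pochhammer b (Suc n) / (pochhammer c (Suc n) * pochhammer d (Suc n))" for n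
    using exps[of "of_real (ln (of_nat n))"]
    by (simp add: rGamma_series_def)
  moreover have "rGamma a * rGamma b / (rGamma c * rGamma d) = Gamma c * Gamma d / (Gamma a * Gamma b)"
    by (simp add: rGamma_inverse_Gamma divide_inverse mult_ac)
  ultimately show ?thesis
    by (simp add: LIMSEQ_imp_Suc)
qed

lemma norm_add_of_nat_ge:
  fixes c :: complex
  assumes "Re c \<ge> r"
  shows "norm (c + of_nat n) \<ge> r + n"
  using complex_Re_le_cmod[of "c + of_nat n"] assms by simp

text \<open>Consecutive quotients differ from 1 only at order 1/n^2, so the increments are dominated
  by the telescoping differences K/n - K/(n+1), and summing them to infinity leaves K/n.\<close>

lemma pochhammer_ratio_rate:
  fixes a b c d :: complex
  assumes sum: "a + b = c + d" and c: "Re c \<ge> 1" and d: "Re d \<ge> 0" "d \<noteq> 0"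
  defines "r \<equiv> \<lambda>n::nat. pochhammer a n * pochhammer b n / (pochhammer c n * pochhammer d n)"
  obtains K where "\<And>n::nat. n \<ge> 1 \<Longrightarrow>
      norm (r n - Gamma c * Gamma d / (Gamma a * Gamma b)) \<le> K / n"
proof -
  have nonpos: "c \<notin> \<int>\<^sub>\<le>\<^sub>0" "d \<notin> \<int>\<^sub>\<le>\<^sub>0"
    using c d by (auto elim!: nonpos_Ints_cases)
  note lim = pochhammer_ratio_limit[OF sum nonpos, folded r_def]
  then obtain B where B: "B > 0" "\<And>n. norm (r n) \<le> B"
    using convergent_imp_Bseq[of r] by (auto simp: convergent_def elim!: BseqE)
  define K where "K = B * norm (a * b - c * d)"
  have K: "K \<ge> 0" using B by (simp add: K_def)
  have step: "norm (r (Suc n) - r n) \<le> K / n - K / Suc n" if n: "n \<ge> 1" for n :: nat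
  proof -
    have c1: "norm (c + of_nat n) \<ge> Suc n" and d1: "norm (d + of_nat n) \<ge> n"
      using norm_add_of_nat_ge[of 1 c n] norm_add_of_nat_ge[of 0 d n] c d by auto
    have nz: "c + of_nat n \<noteq> 0" "d + of_nat n \<noteq> 0"
      using c1 d1 n by auto
    have "r (Suc n) = r n * ((a + of_nat n) * (b + of_nat n) / ((c + of_nat n) * (d + of_nat n)))"
      by (simp add: r_def pochhammer_rec' mult_ac)
    \<comment> \<open>Equal sums remove the term linear in n; the constant a*b - c*d that survives
      is the factor in \<open>K\<close>.\<close>
    also have "(a + of_nat n) * (b + of_nat n) = (c + of_nat n) * (d + of_nat n) + (a * b - c * d)"
    proof -
      have "(a + of_nat n) * (b + of_nat n) = a * b + (a + b) * of_nat n + of_nat n * of_nat n"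
        by (simp add: algebra_simps)
      then show ?thesis unfolding sum by (simp add: algebra_simps)
    qed
    finally have "r (Suc n) - r n = r n * ((a * b - c * d) / ((c + of_nat n) * (d + of_nat n)))"
      using nz by (simp add: add_divide_distrib distrib_left [of "r n"] del: distrib_left_numeral)
    then have "norm (r (Suc n) - r n)
        = norm (r n) * norm (a * b - c * d) / (norm (c + of_nat n) * norm (d + of_nat n))"
      by (simp add: norm_mult norm_divide)
    also have "\<dots> \<le> K / (Suc n * n)"
      unfolding K_def of_nat_mult using c1 d1 n B
      by (intro frac_le mult_mono mult_pos_pos mult_nonneg_nonneg) auto
    also have "\<dots> = K / n - K / Suc n"
      using n by (simp add: field_simps)
    finally show ?thesis .
  qed
  have tele: "norm (r (n + m) - r n) \<le> K / n - K / (n + m)" if n: "n \<ge> 1" for n m :: nat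
  proof (induction m)
    case (Suc m)
    have "norm (r (n + Suc m) - r n) \<le> norm (r (Suc (n + m)) - r (n + m)) + norm (r (n + m) - r n)"
      using norm_triangle_ineq[of "r (Suc (n + m)) - r (n + m)" "r (n + m) - r n"] by simp
    also have "\<dots> \<le> K / n - K / (n + Suc m)"
      using step[of "n + m"] Suc n by simp
    finally show ?case .
  qed auto
  have "norm (r n - Gamma c * Gamma d / (Gamma a * Gamma b)) \<le> K / n" if n: "n \<ge> 1" for n :: nat
  proof -
    have "(\<lambda>m. norm (r (m + n) - r n)) \<longlonglongrightarrow> norm (Gamma c * Gamma d / (Gamma a * Gamma b) - r n)"
      by (intro tendsto_intros LIMSEQ_ignore_initial_segment lim)
    moreover have "norm (r (m + n) - r n) \<le> K / n" for m
    proof -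
      have "0 \<le> K / (n + m)" using K by simp
      then show ?thesis using tele[OF n, of m] by (simp add: add.commute)
    qed
    ultimately have "norm (Gamma c * Gamma d / (Gamma a * Gamma b) - r n) \<le> K / n"
      by (intro LIMSEQ_le_const2) auto
    then show ?thesis by (simp add: norm_minus_commute)
  qed
  then show ?thesis by (rule that)
qed

text \<open>For imaginary d the power of n in \<open>rGamma_series\<close> has modulus 1, so
  boundedness of that convergent sequence bounds the Pochhammer quotient; comparing n! with (n-1)!
  gains the factor 1/n.\<close>

lemma pochhammer_over_fact_bound:
  fixes d :: complex
  assumes d: "Re d = 0"
  obtains M where "M \<ge> 0" "\<And>n::nat. n \<ge> 1 \<Longrightarrow> norm (pochhammer d n / fact n) \<le> M / n"
proof -
  have "Bseq (rGamma_series d)"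
    using rGamma_series_LIMSEQ[of d] by (intro convergent_imp_Bseq) (auto simp: convergent_def)
  then obtain M where M: "M > 0" "\<And>n. norm (rGamma_series d n) \<le> M"
    by (auto elim!: BseqE)
  have "norm (pochhammer d n / fact n) \<le> M / n" if n: "n \<ge> 1" for n :: nat
  proof -
    obtain m where m: "n = Suc m" using n by (cases n) auto
    have "norm (exp (d * of_real (ln (of_nat m)))) = 1"
      using d by simp
    then have "norm (pochhammer d n / fact n) = norm (rGamma_series d m) / n"
      unfolding m rGamma_series_def norm_divide norm_mult fact_Suc norm_of_nat
      by (simp add: mult.commute)
    also have "\<dots> \<le> M / n" using M(2) by (intro divide_right_mono) auto
    finally show ?thesis .
  qed
  then show ?thesis using M(1) that[of M] by auto
qed

text \<open>
  Since \<open>a + b - c\<close> is imaginary, the coefficients decay only like \<open>1 / n\<close>; the binomial series of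
  \<open>(1 - x) powr (c - a - b)\<close> carries all of the leading term, and the remainder is \<open>O (1 / n\<^sup>2)\<close>.
\<close>

lemma hypergeo_coeff_asymp:
  fixes a b c d :: complex
  assumes "a + b = c + d" "Re c \<ge> 1" "Re d = 0" "d \<noteq> 0"
  defines "L \<equiv> Gamma c * Gamma d / (Gamma a * Gamma b)"
  shows "summable (\<lambda>n. norm (hypergeo_coeff a b c n - L * (pochhammer d n / fact n)))"
proof -
  obtain K where K: "\<And>n::nat. n \<ge> 1 \<Longrightarrow> norm (pochhammer a n * pochhammer b n / (pochhammer c n * pochhammer d n) - L) \<le> K / n"
    using pochhammer_ratio_rate[of a b c d] assms unfolding L_def by (metis order_refl)
  obtain M where M: "M \<ge> 0" "\<And>n::nat. n \<ge> 1 \<Longrightarrow> norm (pochhammer d n / fact n) \<le> M / n"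
    using pochhammer_over_fact_bound assms by metis
  have dn: "pochhammer d n \<noteq> 0" for n
    using assms(3,4) by (auto simp: pochhammer_eq_0_iff)
  have bound: "norm (hypergeo_coeff a b c n - L * (pochhammer d n / fact n)) \<le> K * M * inverse (real n ^ 2)"
    if n: "n \<ge> 1" for n :: nat
  proof -
    have "hypergeo_coeff a b c n - L * (pochhammer d n / fact n) =
        (pochhammer a n * pochhammer b n / (pochhammer c n * pochhammer d n) - L) * (pochhammer d n / fact n)"
      using dn[of n] by (simp add: hypergeo_coeff_def algebra_simps)
    also have "norm \<dots> \<le> (K / n) * (M / n)"
      unfolding norm_mult using K[OF n] M(2)[OF n] by (intro mult_mono) (auto intro: order_trans[OF norm_ge_zero])
    finally show ?thesis by (simp add: power2_eq_square field_simps)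
  qed
  have "summable (\<lambda>n. K * M * inverse (real n ^ 2))"
    by (intro summable_mult inverse_power_summable) auto
  then show ?thesis
    by (rule summable_comparison_test[OF exI[of _ 1], rotated]) (use bound in \<open>simp only: real_norm_def abs_norm_cancel, blast\<close>)
qed

section \<open>Comparison with the binomial series near the singular point 1\<close>

lemma binomial_series_sums:
  fixes d z :: complex
  assumes "norm z < 1"
  shows "(\<lambda>n. pochhammer d n / fact n * z ^ n) sums (1 - z) powr (- d)"
proof -
  have "(\<lambda>n. ((- d) gchoose n) * (- z) ^ n) sums (1 + (- z)) powr (- d)"
    using assms by (intro gen_binomial_complex) simp
  moreover have "((- d) gchoose n) * (- z) ^ n = pochhammer d n / fact n * z ^ n" for n
  proof -
    have "(- 1) ^ n * (- z) ^ n = z ^ n" by (simp flip: power_mult_distrib)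
    then show ?thesis by (simp add: gbinomial_pochhammer)
  qed
  ultimately show ?thesis by simp
qed

lemma summable_bounded_power:
  fixes e :: "nat \<Rightarrow> complex"
  assumes "summable (\<lambda>n. norm (e n))" "norm z \<le> 1"
  shows "summable (\<lambda>n. e n * z ^ n)"
proof (rule summable_comparison_test[OF _ assms(1)])
  have "norm (e n * z ^ n) \<le> norm (e n)" for n
    using assms(2) by (simp add: norm_mult norm_power mult_left_le power_le_one)
  then show "\<exists>N. \<forall>n\<ge>N. norm (e n * z ^ n) \<le> norm (e n)" by blast
qed

text \<open>Besides isolating the oscillating term, this is the source of convergence in the open
  unit disc, on which \<open>hypergeo_equation\<close> relies.\<close>

lemma hypergeo_decomposition:
  fixes a b c d :: complex
  assumes "a + b = c + d" "Re c \<ge> 1" "Re d = 0" "d \<noteq> 0" "norm z < 1"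
  defines "L \<equiv> Gamma c * Gamma d / (Gamma a * Gamma b)"
  shows "(\<lambda>n. hypergeo_coeff a b c n * z ^ n) sums
     (L * (1 - z) powr (- d) + (\<Sum>n. (hypergeo_coeff a b c n - L * (pochhammer d n / fact n)) * z ^ n))"
proof -
  have "summable (\<lambda>n. (hypergeo_coeff a b c n - L * (pochhammer d n / fact n)) * z ^ n)"
    using assms(5) unfolding L_def
    by (intro summable_bounded_power hypergeo_coeff_asymp assms(1-4)) auto
  from sums_add[OF sums_mult[OF binomial_series_sums[OF assms(5)], of L d] summable_sums[OF this]]
  show ?thesis by (simp add: algebra_simps)
qed

text \<open>The remainder has absolutely summable coefficients, so the Weierstrass test makes it
  continuous up to the boundary point, and \<alpha> is its value there. No closed form of \<alpha>
  is claimed; \<open>jost_absorption_solution\<close> identifies the corresponding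
  amplitude.\<close>

lemma hypergeo_near_1:
  fixes a b c d :: complex
  assumes "a + b = c + d" "Re c \<ge> 1" "Re d = 0" "d \<noteq> 0"
  defines "L \<equiv> Gamma c * Gamma d / (Gamma a * Gamma b)"
  obtains \<alpha> where
    "((\<lambda>u. hypergeo a b c (of_real (1 - u)) - L * of_real u powr (- d)) \<longlongrightarrow> \<alpha>) (at_right 0)"
proof -
  define e where "e = (\<lambda>n. hypergeo_coeff a b c n - L * (pochhammer d n / fact n))"
  have sm: "summable (\<lambda>n. norm (e n))"
    unfolding e_def L_def using assms by (intro hypergeo_coeff_asymp)
  define g where "g = (\<lambda>x::real. \<Sum>n. e n * of_real x ^ n)"
  have "uniform_limit {0..1} (\<lambda>n x. \<Sum>i<n. e i * of_real x ^ i) g sequentially"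
    unfolding g_def
    by (intro Weierstrass_m_test[OF _ sm])
       (auto simp: norm_mult norm_power intro!: mult_left_le power_le_one)
  then have "continuous_on {0..1} g"
    by (rule uniform_limit_theorem[rotated]) (auto intro!: always_eventually continuous_intros)
  then have "continuous (at 1 within {0..1}) g"
    by (simp add: continuous_on_eq_continuous_within)
  then have "(g \<longlongrightarrow> g 1) (at 1 within {0..1})"
    by (simp add: continuous_within)
  then have lim: "(g \<longlongrightarrow> g 1) (at_left 1)"
    by (simp add: at_within_Icc_at_left)
  have "filterlim (\<lambda>u::real. 1 - u) (at_left 1) (at_right 0)"
    by (auto simp: filterlim_at eventually_at_filter intro!: tendsto_eq_intros)
  from filterlim_compose[OF lim this]
  have "((\<lambda>u. g (1 - u)) \<longlongrightarrow> g 1) (at_right 0)" .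
  moreover have "eventually (\<lambda>u. g (1 - u) = hypergeo a b c (of_real (1 - u)) - L * of_real u powr (- d)) (at_right 0)"
    using eventually_at_right_real[of 0 1, OF zero_less_one]
  proof eventually_elim
    case (elim u)
    then have "norm (of_real (1 - u) :: complex) < 1" by (simp only: norm_of_real) auto
    from hypergeo_decomposition[OF assms(1-4) this, THEN sums_unique]
    have "hypergeo a b c (of_real (1 - u)) = L * of_real u powr (- d) + g (1 - u)"
      by (simp add: g_def hypergeo_def e_def L_def)
    then show ?case by simp
  qed
  ultimately show ?thesis
    by (intro that) (rule Lim_transform_eventually)
qed

section \<open>The hypergeometric differential equation\<close>

lemma hypergeo_coeff_Suc:
  assumes "Re c > 0"
  shows "of_nat (Suc n) * (c + of_nat n) * hypergeo_coeff a b c (Suc n)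
       = (a + of_nat n) * (b + of_nat n) * hypergeo_coeff a b c n"
proof -
  have "c + of_nat n \<noteq> 0" using assms by (auto simp: complex_eq_iff)
  moreover have "hypergeo_coeff a b c (Suc n)
      = (a + of_nat n) * (b + of_nat n) * hypergeo_coeff a b c n / (of_nat (Suc n) * (c + of_nat n))"
    by (simp add: hypergeo_coeff_def pochhammer_rec' mult_ac del: of_nat_Suc)
  ultimately show ?thesis by (simp del: of_nat_Suc)
qed

text \<open>This is z d/dz acting termwise. It brings every term of the differential equation to the
  same power \<open>z ^ n\<close>, so that coefficients can be compared without reindexing.\<close>

lemma power_series_shift_sums:
  fixes g :: "nat \<Rightarrow> complex"
  assumes "(\<lambda>n. diffs g n * z ^ n) sums s"
  shows "(\<lambda>n. of_nat n * g n * z ^ n) sums (z * s)"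
proof -
  have "(\<lambda>n. of_nat (Suc n) * g (Suc n) * z ^ Suc n) sums (z * s)"
    using sums_mult[OF assms, of z] by (simp add: diffs_def mult_ac del: of_nat_Suc)
  then show ?thesis
    by (subst (asm) sums_Suc_iff) simp
qed

text \<open>Coefficientwise the equation is the recurrence \<open>hypergeo_coeff_Suc\<close>. The
  assumptions are those of \<open>hypergeo_decomposition\<close>, which yields convergence and with
  it termwise differentiation.\<close>

lemma hypergeo_equation:
  fixes a b c d :: complex
  assumes ab: "a + b = c + d" "Re c \<ge> 1" "Re d = 0" "d \<noteq> 0"
  obtains F' F'' where
    "\<And>z. norm z < 1 \<Longrightarrow> (hypergeo a b c has_field_derivative F' z) (at z)"
    "\<And>z. norm z < 1 \<Longrightarrow> (F' has_field_derivative F'' z) (at z)"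
    "\<And>z. norm z < 1 \<Longrightarrow>
       z * (1 - z) * F'' z + (c - (a + b + 1) * z) * F' z - a * b * hypergeo a b c z = 0"
proof -
  define h where "h = hypergeo_coeff a b c"
  define F' where "F' = (\<lambda>z. \<Sum>n. diffs h n * z ^ n)"
  define F'' where "F'' = (\<lambda>z. \<Sum>n. diffs (diffs h) n * z ^ n)"
  have sm: "summable (\<lambda>n. h n * z ^ n)" if "norm z < 1" for z
    using hypergeo_decomposition[OF ab that] by (auto simp: h_def sums_iff)
  have sm': "summable (\<lambda>n. diffs h n * z ^ n)" if "norm z < 1" for z
    using that by (rule termdiff_converges) (rule sm)
  have sm'': "summable (\<lambda>n. diffs (diffs h) n * z ^ n)" if "norm z < 1" for z
    using that by (rule termdiff_converges) (rule sm')
  have "(hypergeo a b c has_field_derivative F' z) (at z)" if "norm z < 1" for z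
    using termdiffs_strong'[OF sm that]
    by (simp add: F'_def h_def hypergeo_def[abs_def])
  moreover have "(F' has_field_derivative F'' z) (at z)" if "norm z < 1" for z
    using termdiffs_strong'[OF sm' that] by (simp add: F'_def F''_def)
  moreover have "z * (1 - z) * F'' z + (c - (a + b + 1) * z) * F' z - a * b * hypergeo a b c z = 0"
    if z: "norm z < 1" for z
  proof -
    have S0: "(\<lambda>n. h n * z ^ n) sums hypergeo a b c z"
      using sm[OF z] by (simp add: h_def hypergeo_def summable_sums)
    have S1: "(\<lambda>n. diffs h n * z ^ n) sums F' z"
      using sm'[OF z] by (simp add: F'_def summable_sums)
    have S2: "(\<lambda>n. diffs (diffs h) n * z ^ n) sums F'' z"
      using sm''[OF z] by (simp add: F''_def summable_sums)
    have S1': "(\<lambda>n. of_nat n * h n * z ^ n) sums (z * F' z)"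
      by (rule power_series_shift_sums[OF S1])
    have S2': "(\<lambda>n. of_nat n * diffs h n * z ^ n) sums (z * F'' z)"
      by (rule power_series_shift_sums[OF S2])
    \<comment> \<open>The series of z F'' is read as the derivative of z F' - F, so that a second
      shift gives z^2 F'' with coefficients n (n - 1) h(n).\<close>
    have "(\<lambda>n. (diffs (\<lambda>n. of_nat n * h n - h n) n) * z ^ n) sums (z * F'' z)"
      using S2' by (simp add: diffs_def algebra_simps)
    from power_series_shift_sums[OF this]
    have S2'': "(\<lambda>n. of_nat n * (of_nat n * h n - h n) * z ^ n) sums (z * (z * F'' z))" .
    have "(\<lambda>n. of_nat n * diffs h n * z ^ n - of_nat n * (of_nat n * h n - h n) * z ^ n
              + c * (diffs h n * z ^ n) - (a + b + 1) * (of_nat n * h n * z ^ n)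
              - a * b * (h n * z ^ n)) sums
          (z * F'' z - z * (z * F'' z) + c * F' z - (a + b + 1) * (z * F' z)
              - a * b * hypergeo a b c z)"
      by (intro sums_diff sums_add sums_mult S0 S1 S1' S2' S2'')
    moreover have "of_nat n * diffs h n * z ^ n - of_nat n * (of_nat n * h n - h n) * z ^ n
              + c * (diffs h n * z ^ n) - (a + b + 1) * (of_nat n * h n * z ^ n)
              - a * b * (h n * z ^ n) = 0" for n
    proof -
      have "(c + of_nat n) * diffs h n = (a + of_nat n) * (b + of_nat n) * h n"
        using hypergeo_coeff_Suc[of c n a b] ab(2) by (simp add: h_def diffs_def mult_ac)
      then have "((c + of_nat n) * diffs h n - (a + of_nat n) * (b + of_nat n) * h n) * z ^ n = 0"
        by simp
      then show ?thesis by (simp add: algebra_simps)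
    qed
    ultimately have "(\<lambda>n. 0) sums (z * F'' z - z * (z * F'' z) + c * F' z - (a + b + 1) * (z * F' z)
              - a * b * hypergeo a b c z)" by simp
    then have "z * F'' z - z * (z * F'' z) + c * F' z - (a + b + 1) * (z * F' z)
              - a * b * hypergeo a b c z = 0"
      using sums_0 sums_unique2 by blast
    then show ?thesis by (simp add: algebra_simps)
  qed
  ultimately show ?thesis by (rule that)
qed

lemma hypergeo_0: "hypergeo a b c 0 = 1"
  unfolding hypergeo_def powser_zero by (simp add: hypergeo_coeff_def)

section \<open>The tortoise coordinate\<close>

text \<open>The logistic function, inverse to \<open>tortoise\<close>. It is defined on the whole
  line, so equations in v need no domain condition.\<close>

definition radius :: "real \<Rightarrow> real" where
  "radius v = 1 / (1 + exp (- v))"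

lemma radius_bounds [simp]: "0 < radius v" "radius v < 1"
  by (auto simp: radius_def field_simps add_pos_pos)

lemma radius_simps [simp]: "radius v \<noteq> 0" "radius v \<noteq> 1" "\<not> radius v < 0" "0 \<le> radius v"
  using radius_bounds[of v] by linarith+

lemma radius_in: "radius v \<in> {0<..<1}"
  by simp

lemma one_minus_radius: "1 - radius v = exp (- v) / (1 + exp (- v))"
proof -
  have "1 + exp (- v) \<noteq> 0" using exp_gt_zero[of "- v"] by linarith
  then show ?thesis by (simp add: radius_def field_simps)
qed

lemma tortoise_radius [simp]: "tortoise (radius v) = v"
proof -
  have "1 + exp (- v) > 0" using exp_gt_zero[of "- v"] by linarith
  then show ?thesis
    unfolding tortoise_def one_minus_radius by (simp add: ln_div radius_def)
qed

lemma radius_tortoise [simp]: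
  assumes "u \<in> {0<..<1}"
  shows "radius (tortoise u) = u"
proof -
  have "exp (- tortoise u) = (1 - u) / u"
    using assms by (simp add: tortoise_def exp_diff)
  then show ?thesis using assms unfolding radius_def by (simp add: add_divide_distrib [symmetric] diff_divide_distrib)
qed

lemma ln_radius: "ln (radius v) = v + ln (1 - radius v)"
  using tortoise_radius[of v] unfolding tortoise_def by linarith

lemma has_real_derivative_radius:
  "(radius has_real_derivative radius v * (1 - radius v)) (at v)"
proof -
  have *: "1 + exp (- v) > 0" using exp_gt_zero[of "- v"] by linarith
  show ?thesis
    unfolding radius_def[abs_def] using *
    by (auto intro!: derivative_eq_intros simp: field_simps power2_eq_square)
qed

lemma has_real_derivative_tortoise:
  assumes "u \<in> {0<..<1}"
  shows "(tortoise has_real_derivative 1 / (u * (1 - u))) (at u)"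
  unfolding tortoise_def[abs_def] using assms
  by (auto intro!: derivative_eq_intros simp: field_simps)

lemma radius_at_top: "filterlim radius (at_left 1) at_top"
proof -
  have "(radius \<longlongrightarrow> 1 / (1 + 0)) at_top"
    unfolding radius_def[abs_def]
    by (intro tendsto_intros filterlim_compose[OF exp_at_bot filterlim_uminus_at_bot_at_top]) auto
  then show ?thesis
    by (auto simp: filterlim_at intro!: always_eventually)
qed

lemma radius_at_bot: "filterlim radius (at_right 0) at_bot"
proof -
  have "filterlim (\<lambda>v::real. 1 + exp (- v)) at_top at_bot"
    by (intro filterlim_tendsto_add_at_top[OF tendsto_const]
          filterlim_compose[OF exp_at_top filterlim_uminus_at_top_at_bot])
  then have "(radius \<longlongrightarrow> 0) at_bot"
    unfolding radius_def[abs_def]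
    by (intro real_tendsto_divide_at_top[OF tendsto_const])
  then show ?thesis
    by (auto simp: filterlim_at intro!: always_eventually)
qed

section \<open>Reduction to a Schroedinger equation\<close>

text \<open>The coefficients are real, so solutions are closed under complex conjugation. The
  derivative is an argument because Wronskians and currents refer to it.\<close>

definition second_order_equation ::
    "(real \<Rightarrow> real) \<Rightarrow> (real \<Rightarrow> real) \<Rightarrow> (real \<Rightarrow> complex) \<Rightarrow> (real \<Rightarrow> complex) \<Rightarrow> bool" where
  "second_order_equation \<alpha> \<beta> f f' \<longleftrightarrow>
    (\<forall>v. (f has_vector_derivative f' v) (at v) \<and>
         (f' has_vector_derivative of_real (\<alpha> v) * f' v + of_real (\<beta> v) * f v) (at v))"

text \<open>Liouville's substitution, with p the logarithmic derivative of P. The choice p = -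
  \<alpha>/2 removes the first-order term, and the reciprocal factor restores it; both directions of
  the reduction use this.\<close>

lemma second_order_equation_mult:
  assumes f: "second_order_equation \<alpha> \<beta> f f'"
    and P: "\<And>v. (P has_real_derivative p v * P v) (at v)"
    and p: "\<And>v. (p has_real_derivative p' v) (at v)"
    and \<alpha>': "\<And>v. \<alpha>' v = \<alpha> v + 2 * p v"
    and \<beta>': "\<And>v. \<beta>' v = \<beta> v + p' v - (p v)\<^sup>2 - \<alpha> v * p v"
  shows "second_order_equation \<alpha>' \<beta>' (\<lambda>v. of_real (P v) * f v)
           (\<lambda>v. of_real (P v) * (f' v + of_real (p v) * f v))"
proof -
  have P': "((\<lambda>v. complex_of_real (P v)) has_vector_derivative of_real (p v * P v)) (at v)" for v
    using P[of v] by (intro has_vector_derivative_of_real) (simp add: has_real_derivative_iff_has_vector_derivative)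
  have p': "((\<lambda>v. complex_of_real (p v)) has_vector_derivative of_real (p' v)) (at v)" for v
    using p[of v] by (intro has_vector_derivative_of_real) (simp add: has_real_derivative_iff_has_vector_derivative)
  show ?thesis
    unfolding second_order_equation_def
  proof (intro allI conjI)
    fix v
    have f1: "(f has_vector_derivative f' v) (at v)"
      and f2: "(f' has_vector_derivative of_real (\<alpha> v) * f' v + of_real (\<beta> v) * f v) (at v)"
      using f by (auto simp: second_order_equation_def)
    show "((\<lambda>v. of_real (P v) * f v) has_vector_derivative
        of_real (P v) * (f' v + of_real (p v) * f v)) (at v)"
      by (rule has_vector_derivative_eq_rhs[OF has_vector_derivative_mult[OF P' f1]])
         (simp add: algebra_simps)
    show "((\<lambda>v. of_real (P v) * (f' v + of_real (p v) * f v)) has_vector_derivative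
        of_real (\<alpha>' v) * (of_real (P v) * (f' v + of_real (p v) * f v))
        + of_real (\<beta>' v) * (of_real (P v) * f v)) (at v)"
      by (rule has_vector_derivative_eq_rhs[OF has_vector_derivative_mult[OF P'
            has_vector_derivative_add[OF f2 has_vector_derivative_mult[OF p' f1]]]])
         (simp add: \<alpha>' \<beta>' algebra_simps power2_eq_square)
  qed
qed

section \<open>Derivatives under the change of radial variable\<close>

lemma has_vector_derivative_radius_compose:
  assumes "(f has_vector_derivative f') (at (radius v))"
  shows "((\<lambda>v. f (radius v)) has_vector_derivative of_real (radius v * (1 - radius v)) * f') (at v)"
  using vector_diff_chain_at[of radius "radius v * (1 - radius v)" v f f'] assms
    has_real_derivative_radius[of v]
  by (simp add: o_def has_real_derivative_iff_has_vector_derivative scaleR_conv_of_real)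

lemma has_vector_derivative_tortoise_compose:
  assumes "u \<in> {0<..<1}" "(f has_vector_derivative f') (at (tortoise u))"
  shows "((\<lambda>u. f (tortoise u)) has_vector_derivative of_real (1 / (u * (1 - u))) * f') (at u)"
  using vector_diff_chain_at[of tortoise "1 / (u * (1 - u))" u f f'] assms
    has_real_derivative_tortoise[of u]
  by (simp only: o_def has_real_derivative_iff_has_vector_derivative scaleR_conv_of_real)

lemma has_vector_derivative_tortoise_deriv:
  assumes "u \<in> {0<..<1}"
  shows "((\<lambda>u. complex_of_real (1 / (u * (1 - u)))) has_vector_derivative
     of_real (- (1 - 2 * u) / (u * (1 - u))\<^sup>2)) (at u)"
proof -
  have "((\<lambda>u. 1 / (u * (1 - u))) has_real_derivative - (1 - 2 * u) / (u * (1 - u))\<^sup>2) (at u)"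
    using assms by (auto intro!: derivative_eq_intros simp: power2_eq_square)
  then show ?thesis
    by (intro has_vector_derivative_of_real) (simp add: has_real_derivative_iff_has_vector_derivative)
qed

lemma has_vector_derivative_complex_of_real_radius:
  "((\<lambda>v. complex_of_real (radius v)) has_vector_derivative of_real (radius v * (1 - radius v))) (at v)"
  using has_real_derivative_radius[of v]
  by (intro has_vector_derivative_of_real) (simp add: has_real_derivative_iff_has_vector_derivative)

lemma has_real_derivative_sqrt_radius:
  "((\<lambda>v. sqrt (radius v)) has_real_derivative (1 - radius v) / 2 * sqrt (radius v)) (at v)"
proof -
  have "radius v * inverse (sqrt (radius v)) = sqrt (radius v)"
    by (simp add: real_div_sqrt less_imp_le flip: divide_inverse)
  then show ?thesis
    by (auto intro!: derivative_eq_intros has_real_derivative_radius simp: mult.commute)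
qed

lemma has_real_derivative_inverse_sqrt_radius:
  "((\<lambda>v. 1 / sqrt (radius v)) has_real_derivative (- (1 - radius v) / 2) * (1 / sqrt (radius v))) (at v)"
proof -
  have "sqrt (radius v) \<noteq> 0" by simp
  from DERIV_divide[OF DERIV_const has_real_derivative_sqrt_radius this, of 1]
  moreover have "(0 * s - 1 * ((1 - r) / 2 * s)) / (s * s) = (- (1 - r) / 2) * (1 / s)"
    if "s \<noteq> 0" for r s :: real
    using that by (simp add: field_simps)
  ultimately show ?thesis using \<open>sqrt (radius v) \<noteq> 0\<close> by (metis DERIV_cong)
qed

lemma has_real_derivative_half_one_minus_radius:
  "((\<lambda>v. (1 - radius v) / 2) has_real_derivative - (radius v * (1 - radius v) / 2)) (at v)"
  "((\<lambda>v. - (1 - radius v) / 2) has_real_derivative radius v * (1 - radius v) / 2) (at v)"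
  by (auto intro!: derivative_eq_intros has_real_derivative_radius)

text \<open>It vanishes at the horizon and tends to (q^2 + 1)/4 at spatial infinity, whence the
  momenta w and \<open>wavenumber w q\<close> at the two ends. The number 1 or -3 is four times the
  product of \<open>param_a\<close> and \<open>param_b\<close> at 0, which is how the hypergeometric
  equation reproduces it.\<close>

definition potential :: "sector \<Rightarrow> real \<Rightarrow> real \<Rightarrow> real" where
  "potential X q u = (1 - u) * (q\<^sup>2 + 1 + (case X of Scalar \<Rightarrow> 1 | Shear \<Rightarrow> - 3) * u) / 4"

abbreviation schroedinger :: "sector \<Rightarrow> real \<Rightarrow> real \<Rightarrow> (real \<Rightarrow> complex) \<Rightarrow> (real \<Rightarrow> complex) \<Rightarrow> bool" where
  "schroedinger X w q \<equiv> second_order_equation (\<lambda>v. 0) (\<lambda>v. potential X q (radius v) - w\<^sup>2 / 4)"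

text \<open>Since d/dv = u (1 - u) d/du, the equation in v has the first-order coefficient 1 - u.
  The factor 1 / sqrt u has logarithmic derivative - (1 - u)/2 in v and cancels it.\<close>

lemma mode_Scalar_imp_schroedinger:
  assumes "mode Scalar w q \<psi>"
  shows "\<exists>\<psi>'. schroedinger Scalar w q \<psi> \<psi>'"
proof -
  obtain Z Z' Z'' where Z: "\<And>u. u \<in> {0<..<1} \<Longrightarrow> (Z has_vector_derivative Z' u) (at u)"
      "\<And>u. u \<in> {0<..<1} \<Longrightarrow> (Z' has_vector_derivative Z'' u) (at u)"
    and eq: "\<And>u. u \<in> {0<..<1} \<Longrightarrow> Z'' u - Z' u / of_real (1 - u)
        + of_real ((w\<^sup>2 - (1 - u) * q\<^sup>2) / (4 * u\<^sup>2 * (1 - u)\<^sup>2)) * Z u = 0"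
    and \<psi>: "\<And>u. u \<in> {0<..<1} \<Longrightarrow> Z u = of_real (sqrt u) * \<psi> (tortoise u)"
    using assms unfolding mode.simps scalar_perturbation_def by metis
  have "second_order_equation (\<lambda>v. 1 - radius v) (\<lambda>v. - (w\<^sup>2 - (1 - radius v) * q\<^sup>2) / 4)
     (\<lambda>v. Z (radius v)) (\<lambda>v. of_real (radius v) * (1 - of_real (radius v)) * Z' (radius v))"
    unfolding second_order_equation_def
  proof (intro allI conjI)
    fix v
    show "((\<lambda>v. Z (radius v)) has_vector_derivative
        of_real (radius v) * (1 - of_real (radius v)) * Z' (radius v)) (at v)"
      using has_vector_derivative_radius_compose[OF Z(1)[OF radius_in]] by simp
    define u where "u = radius v"
    have u: "u \<in> {0<..<1}" by (simp add: u_def)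
    have nz: "complex_of_real u \<noteq> 0" "1 - complex_of_real u \<noteq> 0"
      using u by (auto simp: complex_eq_iff)
    have Z'': "Z'' u = Z' u / (1 - of_real u)
        - of_real (w\<^sup>2 - (1 - u) * q\<^sup>2) / (4 * (of_real u)\<^sup>2 * (1 - of_real u)\<^sup>2) * Z u"
      using eq[OF u] by (simp add: algebra_simps)
    have "((\<lambda>v. of_real (radius v) * (1 - of_real (radius v)) * Z' (radius v)) has_vector_derivative
      of_real u * (1 - of_real u) * ((1 - 2 * of_real u) * Z' u + of_real u * (1 - of_real u) * Z'' u)) (at v)"
      by (rule has_vector_derivative_eq_rhs[OF has_vector_derivative_mult[OF
            has_vector_derivative_mult[OF has_vector_derivative_complex_of_real_radius
              has_vector_derivative_diff[OF has_vector_derivative_const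
                has_vector_derivative_complex_of_real_radius]]
            has_vector_derivative_radius_compose[OF Z(2)[OF radius_in]]]])
         (simp add: u_def algebra_simps)
    also have "of_real u * (1 - of_real u) * ((1 - 2 * of_real u) * Z' u + of_real u * (1 - of_real u) * Z'' u)
       = of_real (1 - u) * (of_real u * (1 - of_real u) * Z' u) + of_real (- (w\<^sup>2 - (1 - u) * q\<^sup>2) / 4) * Z u"
      unfolding Z'' using nz by (simp add: divide_simps) (simp add: algebra_simps power2_eq_square)
    finally show "((\<lambda>v. of_real (radius v) * (1 - of_real (radius v)) * Z' (radius v)) has_vector_derivative
          of_real (1 - radius v) * (of_real (radius v) * (1 - of_real (radius v)) * Z' (radius v))
          + of_real (- (w\<^sup>2 - (1 - radius v) * q\<^sup>2) / 4) * Z (radius v)) (at v)"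
      by (simp only: u_def)
  qed
  from second_order_equation_mult[OF this has_real_derivative_inverse_sqrt_radius
      has_real_derivative_half_one_minus_radius(2),
      of "\<lambda>v. 0" "\<lambda>v. potential Scalar q (radius v) - w\<^sup>2 / 4"]
  obtain \<psi>' where "schroedinger Scalar w q (\<lambda>v. of_real (1 / sqrt (radius v)) * Z (radius v)) \<psi>'"
    by (auto simp: potential_def field_simps power2_eq_square)
  moreover have "(\<lambda>v. of_real (1 / sqrt (radius v)) * Z (radius v)) = \<psi>"
    using \<psi> radius_bounds(1) by (auto simp: less_imp_neq[THEN not_sym])
  ultimately show ?thesis by auto
qed

lemma schroedinger_imp_mode_Scalar:
  assumes "schroedinger Scalar w q \<psi> \<psi>'"
  shows "mode Scalar w q \<psi>"
proof -
  obtain g where g: "second_order_equation (\<lambda>v. 1 - radius v) (\<lambda>v. - (w\<^sup>2 - (1 - radius v) * q\<^sup>2) / 4)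
     (\<lambda>v. of_real (sqrt (radius v)) * \<psi> v) g"
    using second_order_equation_mult[OF assms has_real_derivative_sqrt_radius
      has_real_derivative_half_one_minus_radius(1),
      of "\<lambda>v. 1 - radius v" "\<lambda>v. - (w\<^sup>2 - (1 - radius v) * q\<^sup>2) / 4"]
    by (auto simp: potential_def field_simps power2_eq_square)
  define f where "f = (\<lambda>v. complex_of_real (sqrt (radius v)) * \<psi> v)"
  have f: "(f has_vector_derivative g v) (at v)"
     "(g has_vector_derivative of_real (1 - radius v) * g v
         + of_real (- (w\<^sup>2 - (1 - radius v) * q\<^sup>2) / 4) * f v) (at v)" for v
    using g by (auto simp: second_order_equation_def f_def)
  define Z' where "Z' = (\<lambda>u. of_real (1 / (u * (1 - u))) * g (tortoise u))"
  \<comment> \<open>From differentiating \<open>Z'\<close>: the terms in g combine as (1 - u) - (1 -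
    2 u) = u, and the equation for g contributes the term in f.\<close>
  define Z'' where "Z'' = (\<lambda>u. (of_real u * g (tortoise u)
         - of_real ((w\<^sup>2 - (1 - u) * q\<^sup>2) / 4) * f (tortoise u)) / of_real ((u * (1 - u))\<^sup>2))"
  have "scalar_perturbation w q (\<lambda>u. f (tortoise u))"
    unfolding scalar_perturbation_def
  proof (rule exI[of _ Z'], rule exI[of _ Z''], intro ballI conjI)
    fix u :: real assume u: "u \<in> {0<..<1}"
    show "((\<lambda>u. f (tortoise u)) has_vector_derivative Z' u) (at u)"
      unfolding Z'_def by (rule has_vector_derivative_tortoise_compose[OF u f(1)])
    show "(Z' has_vector_derivative Z'' u) (at u)"
      unfolding Z'_def
      by (rule has_vector_derivative_eq_rhs[OF has_vector_derivative_mult[OF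
            has_vector_derivative_tortoise_deriv[OF u]
            has_vector_derivative_tortoise_compose[OF u f(2)]]])
         (use u in \<open>simp add: Z''_def power2_eq_square divide_simps\<close>, simp add: algebra_simps)
    have nz: "complex_of_real u \<noteq> 0" "1 - complex_of_real u \<noteq> 0"
      using u by (auto simp: complex_eq_iff)
    show "Z'' u - Z' u / of_real (1 - u)
        + of_real ((w\<^sup>2 - (1 - u) * q\<^sup>2) / (4 * u\<^sup>2 * (1 - u)\<^sup>2)) * f (tortoise u) = 0"
      unfolding Z'_def Z''_def using nz
      by (simp add: divide_simps) (simp add: algebra_simps power2_eq_square)
  qed
  moreover have "\<forall>u\<in>{0<..<1}. f (tortoise u) = of_real (sqrt u) * \<psi> (tortoise u)"
    by (simp add: f_def)
  ultimately show ?thesis by auto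
qed


text \<open>The two metric components decouple through F = q w Htx + w^2 Hzx. The equation for Hzx''
  says that (1 - u) Hzx' has v-derivative - F / (4 u), while the constraint turns F' into (w^2 - (1
  - u) q^2) Hzx'. So (1 - u) Hzx' obeys a closed equation, whose first-order term the factor sqrt u
  removes.\<close>

lemma mode_Shear_imp_schroedinger:
  assumes "mode Shear w q \<psi>" "w \<noteq> 0"
  shows "\<exists>\<psi>'. schroedinger Shear w q \<psi> \<psi>'"
proof -
  obtain Htx Hzx where "shear_perturbation w q Htx Hzx" and
    \<psi>: "(\<forall>u\<in>{0<..<1}. \<psi> (tortoise u) = of_real (sqrt u) * vector_derivative Htx (at u)) \<or>
       (\<forall>u\<in>{0<..<1}. \<psi> (tortoise u) =
          of_real (sqrt u * (1 - u)) * vector_derivative Hzx (at u))"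
    using assms by auto
  then obtain Htx' Htx'' Hzx' Hzx'' where
    H: "\<And>u. u \<in> {0<..<1} \<Longrightarrow> (Htx has_vector_derivative Htx' u) (at u)"
      "\<And>u. u \<in> {0<..<1} \<Longrightarrow> (Hzx has_vector_derivative Hzx' u) (at u)"
      "\<And>u. u \<in> {0<..<1} \<Longrightarrow> (Hzx' has_vector_derivative Hzx'' u) (at u)"
    and eq1: "\<And>u. u \<in> {0<..<1} \<Longrightarrow> of_real w * Htx' u + of_real (q * (1 - u)) * Hzx' u = 0"
    and eq2: "\<And>u. u \<in> {0<..<1} \<Longrightarrow> Hzx'' u - Hzx' u / of_real (1 - u)
        + (of_real (q * w) * Htx u + of_real (w\<^sup>2) * Hzx u) / of_real (4 * (1 - u)\<^sup>2 * u\<^sup>2) = 0"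
    unfolding shear_perturbation_def by metis
  define F where "F = (\<lambda>u. complex_of_real (q * w) * Htx u + of_real (w\<^sup>2) * Hzx u)"
  have "second_order_equation (\<lambda>v. - (1 - radius v)) (\<lambda>v. - (w\<^sup>2 - (1 - radius v) * q\<^sup>2) / 4)
     (\<lambda>v. (1 - of_real (radius v)) * Hzx' (radius v)) (\<lambda>v. of_real (- 1 / (4 * radius v)) * F (radius v))"
    unfolding second_order_equation_def
  proof (intro allI conjI)
    fix v
    define u where "u = radius v"
    have u: "u \<in> {0<..<1}" by (simp add: u_def)
    have nz: "complex_of_real u \<noteq> 0" "1 - complex_of_real u \<noteq> 0"
      using u by (auto simp: complex_eq_iff)
    have Hzx'': "Hzx'' u = Hzx' u / (1 - of_real u)
        - F u / (4 * (1 - of_real u)\<^sup>2 * (of_real u)\<^sup>2)"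
      using eq2[OF u] by (simp add: F_def algebra_simps)
    have Htx': "of_real w * Htx' u = - of_real (q * (1 - u)) * Hzx' u"
      using eq1[OF u] by (simp add: add_eq_0_iff)
    show "((\<lambda>v. (1 - of_real (radius v)) * Hzx' (radius v)) has_vector_derivative
        of_real (- 1 / (4 * radius v)) * F (radius v)) (at v)"
      by (rule has_vector_derivative_eq_rhs[OF has_vector_derivative_mult[OF
              has_vector_derivative_diff[OF has_vector_derivative_const
                has_vector_derivative_complex_of_real_radius]
              has_vector_derivative_radius_compose[OF H(3)[OF radius_in]]]],
          unfold u_def [symmetric])
         (use nz in \<open>simp add: Hzx'' divide_simps\<close>, simp add: algebra_simps power2_eq_square)
    have "((\<lambda>v. - 1 / (4 * radius v)) has_real_derivative (1 - u) / (4 * u)) (at v)"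
      using u unfolding u_def
      by (auto intro!: derivative_eq_intros has_real_derivative_radius simp: divide_simps)
    then have i: "((\<lambda>v. complex_of_real (- 1 / (4 * radius v))) has_vector_derivative
         of_real ((1 - u) / (4 * u))) (at v)"
      by (intro has_vector_derivative_of_real) (simp add: has_real_derivative_iff_has_vector_derivative)
    have F': "(F has_vector_derivative of_real (q * w) * Htx' u + of_real (w\<^sup>2) * Hzx' u) (at (radius v))"
      unfolding F_def u_def by (intro has_vector_derivative_add has_vector_derivative_mult_right H radius_in)
    have "of_real (q * w) * Htx' u + of_real (w\<^sup>2) * Hzx' u
        = of_real (w\<^sup>2 - (1 - u) * q\<^sup>2) * Hzx' u"
      using arg_cong[OF Htx', of "\<lambda>x. of_real q * x"] by (simp add: algebra_simps power2_eq_square)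
    note F'' = F'[unfolded this]
    show "((\<lambda>v. of_real (- 1 / (4 * radius v)) * F (radius v)) has_vector_derivative
        of_real (- (1 - radius v)) * (of_real (- 1 / (4 * radius v)) * F (radius v))
        + of_real (- (w\<^sup>2 - (1 - radius v) * q\<^sup>2) / 4) * ((1 - of_real (radius v)) * Hzx' (radius v))) (at v)"
      by (rule has_vector_derivative_eq_rhs[OF has_vector_derivative_mult[OF i
              has_vector_derivative_radius_compose[OF F'']]],
          unfold u_def [symmetric])
         (use nz in \<open>simp add: divide_simps\<close>, simp add: algebra_simps power2_eq_square)
  qed
  from second_order_equation_mult[OF this has_real_derivative_sqrt_radius
      has_real_derivative_half_one_minus_radius(1),
      of "\<lambda>v. 0" "\<lambda>v. potential Shear q (radius v) - w\<^sup>2 / 4"]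
  obtain \<phi>' where \<phi>: "schroedinger Shear w q
      (\<lambda>v. of_real (sqrt (radius v)) * ((1 - of_real (radius v)) * Hzx' (radius v))) \<phi>'"
      (is "schroedinger _ _ _ ?\<phi> _")
    by (auto simp: potential_def field_simps power2_eq_square)
  \<comment> \<open>Both readings of a shear wave function reduce to the same solution up to a
    constant: - q/w for the one from Htx, by the constraint, and 1 for the one from Hzx.\<close>
  have "\<exists>c. \<psi> = (\<lambda>v. c * ?\<phi> v)"
    using \<psi>
  proof
    assume *: "\<forall>u\<in>{0<..<1}. \<psi> (tortoise u) = of_real (sqrt u) * vector_derivative Htx (at u)"
    have "\<psi> v = - of_real (q / w) * ?\<phi> v" for v
    proof -
      have "\<psi> v = of_real (sqrt (radius v)) * Htx' (radius v)"
        using *[rule_format, OF radius_in, of v] vector_derivative_at[OF H(1)[OF radius_in, of v]] by simp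
      moreover have "Htx' (radius v) = - of_real (q / w) * ((1 - of_real (radius v)) * Hzx' (radius v))"
        using eq1[OF radius_in, of v] assms(2) by (simp add: field_simps add_eq_0_iff2)
      ultimately show ?thesis by simp
    qed
    then show ?thesis by blast
  next
    assume *: "\<forall>u\<in>{0<..<1}. \<psi> (tortoise u) = of_real (sqrt u * (1 - u)) * vector_derivative Hzx (at u)"
    have "\<psi> v = 1 * ?\<phi> v" for v
      using *[rule_format, OF radius_in, of v] vector_derivative_at[OF H(2)[OF radius_in, of v]] by simp
    then show ?thesis by blast
  qed
  then obtain c where c: "\<psi> = (\<lambda>v. c * ?\<phi> v)" by blast
  have "schroedinger Shear w q \<psi> (\<lambda>v. c * \<phi>' v)"
    unfolding second_order_equation_def c
  proof (intro allI conjI)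
    fix v
    show "((\<lambda>v. c * ?\<phi> v) has_vector_derivative c * \<phi>' v) (at v)"
      using \<phi> by (intro has_vector_derivative_mult_right) (simp add: second_order_equation_def)
    have "(\<phi>' has_vector_derivative of_real 0 * \<phi>' v + of_real (potential Shear q (radius v) - w\<^sup>2 / 4) * ?\<phi> v) (at v)"
      using \<phi> unfolding second_order_equation_def by blast
    from has_vector_derivative_mult_right[OF this, of c]
    show "((\<lambda>v. c * \<phi>' v) has_vector_derivative of_real 0 * (c * \<phi>' v)
       + of_real (potential Shear q (radius v) - w\<^sup>2 / 4) * (c * ?\<phi> v)) (at v)"
      by (simp add: mult_ac)
  qed
  then show ?thesis by blast
qed

text \<open>The metric components are rebuilt from G = (1 - u) Hzx' and F = - 4 u dG/dv. The
  constraint prescribes Htx' = - (q/w) G, which takes one integration; after that Hzx follows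
  algebraically from F.\<close>

lemma schroedinger_imp_mode_Shear:
  assumes "schroedinger Shear w q \<psi> \<psi>'" "w \<noteq> 0"
  shows "mode Shear w q \<psi>"
proof -
  obtain g where g: "second_order_equation (\<lambda>v. - (1 - radius v)) (\<lambda>v. - (w\<^sup>2 - (1 - radius v) * q\<^sup>2) / 4)
     (\<lambda>v. of_real (1 / sqrt (radius v)) * \<psi> v) g"
    using second_order_equation_mult[OF assms(1) has_real_derivative_inverse_sqrt_radius
      has_real_derivative_half_one_minus_radius(2),
      of "\<lambda>v. - (1 - radius v)" "\<lambda>v. - (w\<^sup>2 - (1 - radius v) * q\<^sup>2) / 4"]
    by (auto simp: potential_def field_simps power2_eq_square)
  define f where "f = (\<lambda>v. complex_of_real (1 / sqrt (radius v)) * \<psi> v)"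
  have f: "(f has_vector_derivative g v) (at v)"
     "(g has_vector_derivative of_real (- (1 - radius v)) * g v
         + of_real (- (w\<^sup>2 - (1 - radius v) * q\<^sup>2) / 4) * f v) (at v)" for v
    using g by (auto simp: second_order_equation_def f_def)
  define G where "G = (\<lambda>u. f (tortoise u))"
  define G' where "G' = (\<lambda>u. of_real (1 / (u * (1 - u))) * g (tortoise u))"
  define F where "F = (\<lambda>u. - 4 * of_real u * g (tortoise u))"
  have G: "(G has_vector_derivative G' u) (at u)" if "u \<in> {0<..<1}" for u
    unfolding G'_def G_def by (rule has_vector_derivative_tortoise_compose[OF that f(1)])
  have F: "(F has_vector_derivative of_real ((w\<^sup>2 - (1 - u) * q\<^sup>2) / (1 - u)) * G u) (at u)"
    if u: "u \<in> {0<..<1}" for u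
  proof -
    have nz: "complex_of_real u \<noteq> 0" "1 - complex_of_real u \<noteq> 0"
      using u by (auto simp: complex_eq_iff)
    have 4: "((\<lambda>u. - 4 * complex_of_real u) has_vector_derivative - 4) (at u)"
      by (auto intro!: derivative_eq_intros)
    show ?thesis unfolding F_def
      by (rule has_vector_derivative_eq_rhs[OF has_vector_derivative_mult[OF 4
            has_vector_derivative_tortoise_compose[OF u f(2)]]])
         (use u nz in \<open>simp add: G_def divide_simps\<close>, simp add: algebra_simps power2_eq_square)
  qed
  have "isCont G u" if "u \<in> {0<..<1}" for u
    using G[OF that] by (rule has_vector_derivative_continuous)
  then obtain J where J: "\<And>u. u \<in> {0<..<1} \<Longrightarrow> (J has_vector_derivative G u) (at u)"
    using einterval_antiderivative[of 0 1 G] by auto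
  define Htx where "Htx = (\<lambda>u. - of_real (q / w) * J u)"
  \<comment> \<open>Solved from F = q w Htx + w^2 Hzx. The field equations contain the components
    only through F and (q/w) F, so the integration constant hidden in J is harmless.\<close>
  define Hzx where "Hzx = (\<lambda>u. of_real (1 / w\<^sup>2) * (F u - of_real (q * w) * Htx u))"
  define Hzx' where "Hzx' = (\<lambda>u. of_real (1 / (1 - u)) * G u)"
  have Htx: "(Htx has_vector_derivative - of_real (q / w) * G u) (at u)" if "u \<in> {0<..<1}" for u
    unfolding Htx_def by (intro has_vector_derivative_mult_right J that)
  have Hzx: "(Hzx has_vector_derivative Hzx' u) (at u)" if u: "u \<in> {0<..<1}" for u
  proof -
    have nz: "1 - complex_of_real u \<noteq> 0"
      using u by (auto simp: complex_eq_iff)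
    show ?thesis unfolding Hzx_def
      by (rule has_vector_derivative_eq_rhs[OF has_vector_derivative_mult_right[OF
            has_vector_derivative_diff[OF F[OF u] has_vector_derivative_mult_right[OF Htx[OF u]]]]])
         (use u nz assms(2) in \<open>simp add: Hzx'_def divide_simps\<close>, simp add: algebra_simps power2_eq_square)
  qed
  have "shear_perturbation w q Htx Hzx"
    unfolding shear_perturbation_def
  proof (rule exI[of _ "\<lambda>u. - of_real (q / w) * G u"], rule exI[of _ "\<lambda>u. - of_real (q / w) * G' u"],
      rule exI[of _ Hzx'], rule exI[of _ "\<lambda>u. of_real (1 / (1 - u)) * G' u + of_real (1 / (1 - u)\<^sup>2) * G u"],
      intro ballI conjI)
    fix u :: real assume u: "u \<in> {0<..<1}"
    have nz: "complex_of_real u \<noteq> 0" "1 - complex_of_real u \<noteq> 0"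
      using u by (auto simp: complex_eq_iff)
    show "(Htx has_vector_derivative - of_real (q / w) * G u) (at u)" by (rule Htx[OF u])
    show "(Hzx has_vector_derivative Hzx' u) (at u)" by (rule Hzx[OF u])
    show "((\<lambda>u. - of_real (q / w) * G u) has_vector_derivative - of_real (q / w) * G' u) (at u)"
      by (intro has_vector_derivative_mult_right G u)
    have "((\<lambda>u. 1 / (1 - u)) has_real_derivative 1 / (1 - u)\<^sup>2) (at u)"
      using u by (auto intro!: derivative_eq_intros simp: power2_eq_square)
    then have "((\<lambda>u. complex_of_real (1 / (1 - u))) has_vector_derivative of_real (1 / (1 - u)\<^sup>2)) (at u)"
      by (intro has_vector_derivative_of_real) (simp add: has_real_derivative_iff_has_vector_derivative)
    from has_vector_derivative_mult[OF this G[OF u]]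
    show "(Hzx' has_vector_derivative of_real (1 / (1 - u)) * G' u + of_real (1 / (1 - u)\<^sup>2) * G u) (at u)"
      unfolding Hzx'_def .
    show "of_real w * (- of_real (q / w) * G u) + of_real (q * (1 - u)) * Hzx' u = 0"
      using nz assms(2) by (simp add: Hzx'_def)
    have comb: "of_real (q * w) * Htx u + of_real (w\<^sup>2) * Hzx u = F u"
      using assms(2) by (simp add: Hzx_def)
    have comb': "of_real (q\<^sup>2) * Htx u + of_real (q * w) * Hzx u = of_real (q / w) * F u"
      unfolding comb [symmetric] using assms(2) by (simp add: field_simps power2_eq_square)
    show "- of_real (q / w) * G' u - (of_real (q\<^sup>2) * Htx u + of_real (q * w) * Hzx u)
            / of_real (4 * (1 - u) * u\<^sup>2) = 0"
      unfolding comb' using nz by (simp add: F_def G'_def divide_simps power2_eq_square)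
    show "of_real (1 / (1 - u)) * G' u + of_real (1 / (1 - u)\<^sup>2) * G u - Hzx' u / of_real (1 - u)
        + (of_real (q * w) * Htx u + of_real (w\<^sup>2) * Hzx u) / of_real (4 * (1 - u)\<^sup>2 * u\<^sup>2) = 0"
      unfolding comb using nz by (simp add: F_def G'_def Hzx'_def divide_simps power2_eq_square)
  qed
  moreover have "\<psi> (tortoise u) = of_real (sqrt u * (1 - u)) * vector_derivative Hzx (at u)"
    if u: "u \<in> {0<..<1}" for u
  proof -
    have nz: "1 - complex_of_real u \<noteq> 0" "complex_of_real (sqrt u) \<noteq> 0"
      using u by (auto simp: complex_eq_iff)
    show ?thesis
      using nz u by (simp add: vector_derivative_at[OF Hzx[OF u]] Hzx'_def G_def f_def)
  qed
  ultimately show ?thesis by auto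
qed

lemma mode_iff_schroedinger:
  assumes "w \<noteq> 0"
  shows "mode X w q \<psi> \<longleftrightarrow> (\<exists>\<psi>'. schroedinger X w q \<psi> \<psi>')"
  using assms mode_Scalar_imp_schroedinger schroedinger_imp_mode_Scalar
    mode_Shear_imp_schroedinger schroedinger_imp_mode_Shear
  by (cases X) blast+

section \<open>The solution normalised at the horizon\<close>

text \<open>The argument stands for s - i w. Changing the sign of s or of w then yields the shifted
  parameters, such as 1 - c + a, c - b and 1 - b, that occur in the other connection
  coefficients.\<close>

definition param_a :: "sector \<Rightarrow> complex \<Rightarrow> complex" where
  "param_a X z = ((case X of Scalar \<Rightarrow> 1 | Shear \<Rightarrow> - 1) + z) / 2"

definition param_b :: "sector \<Rightarrow> complex \<Rightarrow> complex" where
  "param_b X z = ((case X of Scalar \<Rightarrow> 1 | Shear \<Rightarrow> 3) + z) / 2"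

lemma param_add: "param_a X z + param_b X z = 1 + z"
  by (cases X) (simp_all add: param_a_def param_b_def field_simps)

lemma param_mult:
  "param_a X z * param_b X z = (of_real (case X of Scalar \<Rightarrow> 1 | Shear \<Rightarrow> - 3) + 2 * z + z\<^sup>2) / 4"
  by (cases X) (simp_all add: param_a_def param_b_def field_simps power2_eq_square)

text \<open>The exponential of i times this phase is u^(i k/2) (1 - u)^(- i w/2), the prefactor of
  the hypergeometric ansatz after sqrt u has been split off.\<close>

definition jost_phase :: "real \<Rightarrow> real \<Rightarrow> real \<Rightarrow> real" where
  "jost_phase w k v = (k * ln (radius v) - w * ln (1 - radius v)) / 2"

text \<open>
  With \<open>k = wavenumber w q\<close> the hypergeometric parameters are those of \<open>Defs\<close>; both signs of \<open>k\<close> are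
  needed.
\<close>

definition jost :: "sector \<Rightarrow> real \<Rightarrow> real \<Rightarrow> real \<Rightarrow> complex" where
  "jost X w k v = exp (\<i> * of_real (jost_phase w k v)) *
     hypergeo (param_a X (\<i> * of_real (k - w))) (param_b X (\<i> * of_real (k - w)))
       (1 - \<i> * of_real w) (of_real (1 - radius v))"

text \<open>At the horizon the remaining logarithm tends to 0, so the phase is that of the
  transmitted wave. \<open>jost_phase_eq_infinity\<close> eliminates the other logarithm and serves
  the opposite end.\<close>

lemma jost_phase_eq_horizon: "jost_phase w k v = w * v / 2 + (k - w) / 2 * ln (radius v)"
  using ln_radius[of v] unfolding jost_phase_def by (simp add: field_simps)

lemma jost_phase_eq_infinity: "jost_phase w k v = k * v / 2 + (k - w) / 2 * ln (1 - radius v)"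
  unfolding jost_phase_def ln_radius by (simp add: field_simps)

lemma has_real_derivative_jost_phase:
  "(jost_phase w k has_real_derivative (k * (1 - radius v) + w * radius v) / 2) (at v)"
  unfolding jost_phase_def[abs_def]
  by (auto intro!: derivative_eq_intros has_real_derivative_radius simp: field_simps)

lemma has_vector_derivative_exp_ii:
  assumes "(\<theta> has_real_derivative \<theta>') (at v)"
  shows "((\<lambda>v. exp (\<i> * complex_of_real (\<theta> v))) has_vector_derivative
     \<i> * of_real \<theta>' * exp (\<i> * of_real (\<theta> v))) (at v)"
proof -
  have "((\<lambda>v. \<i> * complex_of_real (\<theta> v)) has_vector_derivative \<i> * of_real \<theta>') (at v)"
    using assms by (intro has_vector_derivative_mult_right has_vector_derivative_of_real)
      (simp add: has_real_derivative_iff_has_vector_derivative)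
  from field_vector_diff_chain_at[OF this DERIV_exp]
  show ?thesis by (simp add: o_def)
qed

text \<open>The relation to w and q fixes only k^2, so both signs of k are covered. Multiplying by
  the inverse phase expresses the horizon asymptotics as genuine limits, which can be multiplied in
  Wronskians and currents although the function and its derivative oscillate.\<close>

lemma jost_schroedinger:
  assumes k: "k \<noteq> 0" "k\<^sup>2 = w\<^sup>2 - q\<^sup>2 - 1"
  obtains \<psi>' where "schroedinger X w q (jost X w k) \<psi>'"
    "((\<lambda>v. exp (- \<i> * of_real (w * v / 2)) * jost X w k v) \<longlongrightarrow> 1) at_top"
    "((\<lambda>v. exp (- \<i> * of_real (w * v / 2)) * \<psi>' v) \<longlongrightarrow> \<i> * of_real w / 2) at_top"
proof -
  define z a b c where "z = \<i> * complex_of_real (k - w)" and "a = param_a X z" and "b = param_b X z"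
    and "c = 1 - \<i> * complex_of_real w"
  have "a + b = c + \<i> * of_real k"
    unfolding a_def b_def param_add c_def z_def by (simp add: algebra_simps)
  then obtain F' F'' where
    F: "\<And>z. norm z < 1 \<Longrightarrow> (hypergeo a b c has_field_derivative F' z) (at z)"
    and F': "\<And>z. norm z < 1 \<Longrightarrow> (F' has_field_derivative F'' z) (at z)"
    and eq: "\<And>z. norm z < 1 \<Longrightarrow>
       z * (1 - z) * F'' z + (c - (a + b + 1) * z) * F' z - a * b * hypergeo a b c z = 0"
    using hypergeo_equation[of a b c "\<i> * of_real k"] k(1) by (auto simp: c_def)
  define E where "E = (\<lambda>v. exp (\<i> * of_real (jost_phase w k v)))"
  define p where "p = (\<lambda>v. \<i> * complex_of_real ((k * (1 - radius v) + w * radius v) / 2))"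
  define Y where "Y = (\<lambda>v. hypergeo a b c (of_real (1 - radius v)))"
  define Y' where "Y' = (\<lambda>v. - of_real (radius v * (1 - radius v)) * F' (of_real (1 - radius v)))"
  have jost: "jost X w k = (\<lambda>v. E v * Y v)"
    by (simp add: jost_def[abs_def] E_def Y_def a_def b_def c_def z_def)
  have E: "(E has_vector_derivative p v * E v) (at v)" for v
    unfolding E_def p_def by (rule has_vector_derivative_exp_ii has_real_derivative_jost_phase)+
  have p: "(p has_vector_derivative \<i> * of_real ((w - k) / 2 * (radius v * (1 - radius v)))) (at v)" for v
  proof -
    have "((\<lambda>v. (k * (1 - radius v) + w * radius v) / 2) has_real_derivative
        (w - k) / 2 * (radius v * (1 - radius v))) (at v)"
      by (auto intro!: derivative_eq_intros has_real_derivative_radius simp: field_simps)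
    then show ?thesis unfolding p_def
      by (intro has_vector_derivative_mult_right has_vector_derivative_of_real)
        (simp add: has_real_derivative_iff_has_vector_derivative)
  qed
  have small: "norm (complex_of_real (1 - radius v)) < 1" for v
    unfolding norm_of_real using radius_bounds[of v] by linarith
  have r: "((\<lambda>v. complex_of_real (1 - radius v)) has_vector_derivative
      - of_real (radius v * (1 - radius v))) (at v)" for v
    using has_vector_derivative_diff[OF has_vector_derivative_const
        has_vector_derivative_complex_of_real_radius[of v], of 1] by simp
  have Y: "(Y has_vector_derivative Y' v) (at v)" for v
    using field_vector_diff_chain_at[OF r F[OF small], of v] unfolding Y_def Y'_def o_def .
  have Y': "(Y' has_vector_derivative
      of_real ((radius v * (1 - radius v))\<^sup>2) * F'' (of_real (1 - radius v))
      - of_real (radius v * (1 - radius v) * (1 - 2 * radius v)) * F' (of_real (1 - radius v))) (at v)" for v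
  proof -
    have "((\<lambda>v. - (radius v * (1 - radius v))) has_real_derivative
        - (radius v * (1 - radius v) * (1 - 2 * radius v))) (at v)"
      by (auto intro!: derivative_eq_intros has_real_derivative_radius simp: algebra_simps)
    then have *: "((\<lambda>v. complex_of_real (- (radius v * (1 - radius v)))) has_vector_derivative
        of_real (- (radius v * (1 - radius v) * (1 - 2 * radius v)))) (at v)"
      by (intro has_vector_derivative_of_real) (simp add: has_real_derivative_iff_has_vector_derivative)
    show ?thesis
      using has_vector_derivative_mult[OF * field_vector_diff_chain_at[OF r F'[OF small]]]
      unfolding Y'_def o_def by (simp add: power2_eq_square algebra_simps)
  qed
  have sch: "schroedinger X w q (jost X w k) (\<lambda>v. E v * (p v * Y v + Y' v))"
    unfolding second_order_equation_def jost
  proof (intro allI conjI)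
    fix v
    show "((\<lambda>v. E v * Y v) has_vector_derivative E v * (p v * Y v + Y' v)) (at v)"
      by (rule has_vector_derivative_eq_rhs[OF has_vector_derivative_mult[OF E Y]])
         (simp add: algebra_simps)
    define U where "U = complex_of_real (radius v)"
    define F0 F1 F2 where "F0 = hypergeo a b c (1 - U)" and "F1 = F' (1 - U)" and "F2 = F'' (1 - U)"
    define e where "e = (case X of Scalar \<Rightarrow> 1 :: real | Shear \<Rightarrow> - 3)"
    have q2: "(complex_of_real q)\<^sup>2 = (of_real w)\<^sup>2 - (of_real k)\<^sup>2 - 1"
      using k(2) by (simp flip: of_real_power)
    have F2: "U * (1 - U) * F2 = a * b * F0 - (c - (a + b + 1) * (1 - U)) * F1"
      using eq[OF small, of v] by (simp add: U_def F0_def F1_def F2_def algebra_simps)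
    have "(U * (1 - U))\<^sup>2 * F2 = U * (1 - U) * (U * (1 - U) * F2)"
      by (simp add: power2_eq_square)
    also have "\<dots> = U * (1 - U) * ((of_real e + 2 * z + z\<^sup>2) / 4 * F0 - (c - (2 + z) * (1 - U)) * F1)"
      unfolding F2 unfolding a_def b_def param_mult param_add e_def by (simp add: algebra_simps)
    finally have F2': "(U * (1 - U))\<^sup>2 * F2 = \<dots>" .
    \<comment> \<open>With the second derivative eliminated by the hypergeometric equation, the
      coefficient of \<open>F1\<close> cancels identically and that of \<open>F0\<close> becomes the
      potential term; \<open>q2\<close> brings in the relation between k, w and q.\<close>
    have key: "p v * (p v * F0 - U * (1 - U) * F1) + (p v * (- (U * (1 - U) * F1)) + \<i> * of_real ((w - k) / 2) * (U * (1 - U)) * F0)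
         + ((U * (1 - U))\<^sup>2 * F2 - U * (1 - U) * (1 - 2 * U) * F1)
       = ((1 - U) * ((of_real q)\<^sup>2 + 1 + of_real e * U) / 4 - (of_real w)\<^sup>2 / 4) * F0"
      unfolding F2' q2 unfolding p_def c_def z_def
      by (simp flip: U_def) (simp add: field_simps power2_eq_square)
    have Yv: "Y v = F0" and Y'v: "Y' v = - (U * (1 - U) * F1)"
      by (simp_all add: Y_def Y'_def F0_def F1_def U_def)
    have V: "of_real (potential X q (radius v) - w\<^sup>2 / 4)
        = (1 - U) * ((of_real q)\<^sup>2 + 1 + of_real e * U) / 4 - (of_real w)\<^sup>2 / 4"
      by (simp add: potential_def e_def U_def)
    show "((\<lambda>v. E v * (p v * Y v + Y' v)) has_vector_derivative
        of_real 0 * (E v * (p v * Y v + Y' v)) +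
        of_real (potential X q (radius v) - w\<^sup>2 / 4) * (E v * Y v)) (at v)"
    proof (rule has_vector_derivative_eq_rhs[OF has_vector_derivative_mult[OF E
          has_vector_derivative_add[OF has_vector_derivative_mult[OF p Y] Y']]])
      have "E v * (p v * Y' v + \<i> * of_real ((w - k) / 2 * (radius v * (1 - radius v))) * Y v +
           (of_real ((radius v * (1 - radius v))\<^sup>2) * F'' (of_real (1 - radius v)) -
            of_real (radius v * (1 - radius v) * (1 - 2 * radius v)) * F' (of_real (1 - radius v)))) +
          p v * E v * (p v * Y v + Y' v)
        = E v * (p v * (p v * F0 - U * (1 - U) * F1) + (p v * (- (U * (1 - U) * F1)) + \<i> * of_real ((w - k) / 2) * (U * (1 - U)) * F0)
         + ((U * (1 - U))\<^sup>2 * F2 - U * (1 - U) * (1 - 2 * U) * F1))"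
        unfolding Yv Y'v by (simp add: F1_def F2_def field_simps flip: U_def)
      then show "E v * (p v * Y' v + \<i> * of_real ((w - k) / 2 * (radius v * (1 - radius v))) * Y v +
           (of_real ((radius v * (1 - radius v))\<^sup>2) * F'' (of_real (1 - radius v)) -
            of_real (radius v * (1 - radius v) * (1 - 2 * radius v)) * F' (of_real (1 - radius v)))) +
          p v * E v * (p v * Y v + Y' v)
        = of_real 0 * (E v * (p v * Y v + Y' v)) +
          of_real (potential X q (radius v) - w\<^sup>2 / 4) * (E v * Y v)"
        unfolding key V Yv by (simp add: mult.left_commute)
    qed
  qed
  have [tendsto_intros]: "(radius \<longlongrightarrow> 1) at_top"
    using radius_at_top by (simp add: filterlim_at)
  have phase: "exp (- \<i> * of_real (w * v / 2)) * E v = exp (\<i> * of_real ((k - w) / 2 * ln (radius v)))" for v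
    unfolding E_def jost_phase_eq_horizon by (simp add: algebra_simps flip: exp_add)
  have E_lim: "((\<lambda>v. exp (- \<i> * of_real (w * v / 2)) * E v) \<longlongrightarrow> 1) at_top"
    unfolding phase by (auto intro!: tendsto_eq_intros)
  have lim0: "((\<lambda>v. complex_of_real (1 - radius v)) \<longlongrightarrow> 0) at_top"
    by (auto intro!: tendsto_eq_intros)
  have Y_lim: "(Y \<longlongrightarrow> 1) at_top"
  proof -
    have "isCont (hypergeo a b c) 0" using F[of 0] by (auto intro: DERIV_isCont)
    from isCont_tendsto_compose[OF this lim0]
    show ?thesis by (simp add: Y_def hypergeo_0)
  qed
  have Y'_lim: "(Y' \<longlongrightarrow> 0) at_top"
  proof -
    have "isCont F' 0" using F'[of 0] by (auto intro: DERIV_isCont)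
    from isCont_tendsto_compose[OF this lim0]
    have "((\<lambda>v. F' (of_real (1 - radius v))) \<longlongrightarrow> F' 0) at_top" .
    then show ?thesis unfolding Y'_def by (auto intro!: tendsto_eq_intros)
  qed
  have p_lim: "(p \<longlongrightarrow> \<i> * of_real w / 2) at_top"
    unfolding p_def by (auto intro!: tendsto_eq_intros)
  have "((\<lambda>v. exp (- \<i> * of_real (w * v / 2)) * E v * Y v) \<longlongrightarrow> 1 * 1) at_top"
    by (intro tendsto_mult E_lim Y_lim)
  moreover have "((\<lambda>v. exp (- \<i> * of_real (w * v / 2)) * E v * (p v * Y v + Y' v))
      \<longlongrightarrow> 1 * (\<i> * of_real w / 2 * 1 + 0)) at_top"
    by (intro tendsto_mult tendsto_add E_lim Y_lim Y'_lim p_lim)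
  ultimately show ?thesis
    using that[OF sch] by (simp add: jost mult.assoc)
qed

section \<open>Asymptotics at spatial infinity\<close>

lemma norm_plane_wave [simp]: "norm (plane_wave A p v) = norm A"
  by (simp add: plane_wave_def norm_mult)

text \<open>The constant part of the hypergeometric function multiplies the prefactor exp (i k v/2),
  and its oscillating part u^(- i k), close to exp (- i k v), turns this into the opposite wave.
  Only the amplitude L of the latter is explicit.\<close>

lemma jost_at_infinity:
  fixes w k :: real and X :: sector
  assumes k: "k \<noteq> 0"
  defines "z \<equiv> \<i> * of_real (k - w)"
  defines "L \<equiv> Gamma (1 - \<i> * of_real w) * Gamma (\<i> * of_real k) / (Gamma (param_a X z) * Gamma (param_b X z))"
  obtains \<alpha> where
    "((\<lambda>v. jost X w k v - (plane_wave \<alpha> k v + plane_wave L (- k) v)) \<longlongrightarrow> 0) at_bot"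
proof -
  define F where "F = (\<lambda>v. hypergeo (param_a X z) (param_b X z) (1 - \<i> * of_real w) (of_real (1 - radius v)))"
  have "param_a X z + param_b X z = (1 - \<i> * of_real w) + \<i> * of_real k"
    unfolding param_add z_def by (simp add: algebra_simps)
  then obtain \<alpha> where "((\<lambda>u. hypergeo (param_a X z) (param_b X z) (1 - \<i> * of_real w) (of_real (1 - u))
      - L * of_real u powr (- (\<i> * of_real k))) \<longlongrightarrow> \<alpha>) (at_right 0)"
    using hypergeo_near_1[of "param_a X z" "param_b X z" "1 - \<i> * of_real w" "\<i> * of_real k"] k
    unfolding L_def by auto
  from filterlim_compose[OF this radius_at_bot]
  have F_lim: "((\<lambda>v. F v - L * of_real (radius v) powr (- (\<i> * of_real k))) \<longlongrightarrow> \<alpha>) at_bot"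
    by (simp add: F_def)
  \<comment> \<open>\<open>m x v\<close> is (1 - u)^(i x), which tends to 1. By
    \<open>ln_radius\<close> every discrepancy between a power of u and a plane wave in v has this
    form.\<close>
  define m where "m = (\<lambda>x v. exp (\<i> * complex_of_real (x * ln (1 - radius v))))"
  have r: "(radius \<longlongrightarrow> 0) at_bot"
    using radius_at_bot by (simp add: filterlim_at)
  have m: "(m x \<longlongrightarrow> 1) at_bot" for x
    unfolding m_def by (auto intro!: tendsto_eq_intros r)
  have powr: "of_real (radius v) powr (- (\<i> * of_real k)) = plane_wave 1 (- 2 * k) v * m (- k) v" for v
  proof -
    have "of_real (radius v) powr (- (\<i> * of_real k)) = exp (- (\<i> * of_real k) * of_real (ln (radius v)))"
      by (simp add: powr_def Ln_of_real)
    also have "\<dots> = plane_wave 1 (- 2 * k) v * m (- k) v"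
      unfolding ln_radius plane_wave_def m_def by (simp add: algebra_simps flip: exp_add)
    finally show ?thesis .
  qed
  have jost: "jost X w k v = plane_wave 1 k v * (m ((k - w) / 2) v * F v)" for v
    unfolding jost_def jost_phase_eq_infinity plane_wave_def m_def F_def z_def
    by (simp add: distrib_left exp_add mult_ac)
  have pw: "plane_wave L (- k) v = plane_wave 1 k v * (plane_wave 1 (- 2 * k) v * L)" for v
  proof -
    have "exp (\<i> * complex_of_real (- k * v / 2)) = exp (\<i> * complex_of_real (k * v / 2)) * exp (\<i> * complex_of_real (- 2 * k * v / 2))"
      unfolding exp_add [symmetric] by (rule arg_cong[of _ _ exp]) (simp add: field_simps)
    then show ?thesis by (simp add: plane_wave_def mult_ac)
  qed
  have pw': "plane_wave \<alpha> k v = plane_wave 1 k v * \<alpha>" for v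
    by (simp add: plane_wave_def)
  define M where "M = m ((k - w) / 2)"
  have M: "(M \<longlongrightarrow> 1) at_bot" unfolding M_def by (rule m)
  have "((\<lambda>v. M v * (F v - L * of_real (radius v) powr (- (\<i> * of_real k))) - \<alpha>) \<longlongrightarrow> 1 * \<alpha> - \<alpha>) at_bot"
    by (intro tendsto_intros M F_lim)
  \<comment> \<open>The oscillating wave has no limit, so it is kept as a bounded factor beside one
    that tends to 0.\<close>
  moreover have "((\<lambda>v. (M v * m (- k) v - 1) * plane_wave L (- 2 * k) v) \<longlongrightarrow> 0) at_bot"
  proof (rule tendsto_0_le)
    have "((\<lambda>v. M v * m (- k) v - 1) \<longlongrightarrow> 1 * 1 - 1) at_bot" by (intro tendsto_intros M m)
    then show "((\<lambda>v. M v * m (- k) v - 1) \<longlongrightarrow> 0) at_bot" by simp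
    show "\<forall>\<^sub>F v in at_bot. norm ((M v * m (- k) v - 1) * plane_wave L (- 2 * k) v)
        \<le> norm (M v * m (- k) v - 1) * norm L"
      by (simp only: norm_mult norm_plane_wave) simp
  qed
  ultimately have "((\<lambda>v. (M v * (F v - L * of_real (radius v) powr (- (\<i> * of_real k))) - \<alpha>)
      + (M v * m (- k) v - 1) * plane_wave L (- 2 * k) v) \<longlongrightarrow> 1 * \<alpha> - \<alpha> + 0) at_bot"
    by (rule tendsto_add)
  then have lim: "((\<lambda>v. (M v * (F v - L * of_real (radius v) powr (- (\<i> * of_real k))) - \<alpha>)
      + (M v * m (- k) v - 1) * plane_wave L (- 2 * k) v) \<longlongrightarrow> 0) at_bot" by simp
  have L2: "plane_wave L (- 2 * k) v = plane_wave 1 (- 2 * k) v * L" for v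
    by (simp add: plane_wave_def)
  have "((\<lambda>v. jost X w k v - (plane_wave \<alpha> k v + plane_wave L (- k) v)) \<longlongrightarrow> 0) at_bot"
  proof (rule tendsto_0_le[OF lim, of _ 1], intro always_eventually allI)
    fix v
    have "jost X w k v - (plane_wave \<alpha> k v + plane_wave L (- k) v)
       = plane_wave 1 k v * ((M v * (F v - L * of_real (radius v) powr (- (\<i> * of_real k))) - \<alpha>)
      + (M v * m (- k) v - 1) * plane_wave L (- 2 * k) v)"
      unfolding jost pw pw' powr L2 M_def by (simp add: algebra_simps)
    then show "norm (jost X w k v - (plane_wave \<alpha> k v + plane_wave L (- k) v))
       \<le> norm ((M v * (F v - L * of_real (radius v) powr (- (\<i> * of_real k))) - \<alpha>)
      + (M v * m (- k) v - 1) * plane_wave L (- 2 * k) v) * 1"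
      by (simp only: norm_mult norm_plane_wave) simp
  qed
  then show ?thesis by (rule that)
qed

text \<open>After division by the first wave the sum is f = A + B exp (- i p v). A shift by pi/p
  flips the sign of the second term, so f and its shift add up to 2 A. Hence A = 0, and then B = 0
  because its wave has constant modulus.\<close>

lemma plane_waves_tendsto_0:
  assumes p: "p \<noteq> 0" and F: "F = at_top \<or> F = at_bot"
    and lim: "((\<lambda>v. plane_wave A p v + plane_wave B (- p) v) \<longlongrightarrow> 0) F"
  shows "A = 0" "B = 0"
proof -
  have shift: "filterlim (\<lambda>v. v + pi / p) F F"
    using F
  proof
    assume "F = at_top"
    then show ?thesis
      by (auto simp: filterlim_at_top eventually_at_top_linorder algebra_simps intro!: exI[of _ "_ - pi / p"])
  next
    assume "F = at_bot"
    then show ?thesis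
      by (auto simp: filterlim_at_bot eventually_at_bot_linorder algebra_simps intro!: exI[of _ "_ - pi / p"])
  qed
  have nb: "F \<noteq> bot" using F by (metis trivial_limit_at_top_linorder trivial_limit_at_bot_linorder)
  define f where "f = (\<lambda>v. A + plane_wave B (- 2 * p) v)"
  have f: "(f \<longlongrightarrow> 0) F"
  proof (rule tendsto_0_le[OF lim, of _ 1], intro always_eventually allI)
    fix v
    have "exp (\<i> * complex_of_real (- p * v / 2)) = exp (\<i> * complex_of_real (p * v / 2)) * exp (\<i> * complex_of_real (- 2 * p * v / 2))"
      unfolding exp_add [symmetric] by (rule arg_cong[of _ _ exp]) (simp add: field_simps)
    then have "plane_wave A p v + plane_wave B (- p) v = plane_wave 1 p v * f v"
      by (simp add: f_def plane_wave_def algebra_simps)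
    then show "norm (f v) \<le> norm (plane_wave A p v + plane_wave B (- p) v) * 1"
      by (simp only: norm_mult norm_plane_wave) simp
  qed
  from filterlim_compose[OF f shift]
  have "((\<lambda>v. f (v + pi / p)) \<longlongrightarrow> 0) F" .
  moreover have "f (v + pi / p) = 2 * A - f v" for v
  proof -
    have "exp (\<i> * complex_of_real (- 2 * p * (v + pi / p) / 2))
       = exp (\<i> * complex_of_real (- 2 * p * v / 2)) * exp (- (\<i> * pi))"
      unfolding exp_add [symmetric] using p by (intro arg_cong[of _ _ exp]) (simp add: field_simps)
    then show ?thesis by (simp add: f_def plane_wave_def exp_minus)
  qed
  ultimately have "((\<lambda>v. (2 * A - f v) + f v) \<longlongrightarrow> 0 + 0) F"
    using f by (intro tendsto_add) simp_all
  then show A: "A = 0"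
    using nb by (simp add: tendsto_const_iff)
  have "((\<lambda>v. norm (f v)) \<longlongrightarrow> norm (0::complex)) F" by (intro tendsto_norm f)
  then show "B = 0" using nb unfolding f_def A add_0 norm_plane_wave by (simp add: tendsto_const_iff)
qed

lemma plane_waves_unique:
  assumes p: "p \<noteq> 0" and F: "F = at_top \<or> F = at_bot"
    and "((\<lambda>v. f v - (plane_wave A p v + plane_wave B (- p) v)) \<longlongrightarrow> 0) F"
    and "((\<lambda>v. f v - (plane_wave A' p v + plane_wave B' (- p) v)) \<longlongrightarrow> 0) F"
  shows "A = A'" "B = B'"
proof -
  have "((\<lambda>v. plane_wave (A' - A) p v + plane_wave (B' - B) (- p) v) \<longlongrightarrow> 0) F"
    using tendsto_diff[OF assms(3,4)] by (simp add: plane_wave_def algebra_simps)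
  from plane_waves_tendsto_0[OF p F this] show "A = A'" "B = B'" by simp_all
qed

section \<open>Wronskians and conjugate solutions\<close>

lemma wronskian_constant:
  assumes "second_order_equation (\<lambda>v. 0) \<beta> f f'" "second_order_equation (\<lambda>v. 0) \<beta> g g'"
  obtains c where "\<And>v. f v * g' v - f' v * g v = c"
proof -
  have "((\<lambda>v. f v * g' v - f' v * g v) has_vector_derivative 0) (at v within UNIV)" for v
  proof -
    have "(f has_vector_derivative f' v) (at v)" "(g has_vector_derivative g' v) (at v)"
      "(f' has_vector_derivative of_real 0 * f' v + of_real (\<beta> v) * f v) (at v)"
      "(g' has_vector_derivative of_real 0 * g' v + of_real (\<beta> v) * g v) (at v)"
      using assms unfolding second_order_equation_def by blast+
    note d = this
    show ?thesis
      by (rule has_vector_derivative_eq_rhs[OF has_vector_derivative_diff[OF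
            has_vector_derivative_mult[OF d(1,4)] has_vector_derivative_mult[OF d(3,2)]]]) simp
  qed
  then obtain c where "\<And>v. v \<in> UNIV \<Longrightarrow> f v * g' v - f' v * g v = c"
    using has_vector_derivative_zero_constant[OF convex_UNIV] by blast
  then show ?thesis by (intro that) simp
qed

lemma second_order_equation_cnj:
  assumes "second_order_equation \<alpha> \<beta> f f'"
  shows "second_order_equation \<alpha> \<beta> (\<lambda>v. cnj (f v)) (\<lambda>v. cnj (f' v))"
  unfolding second_order_equation_def
proof (intro allI conjI)
  fix v
  have d: "(f has_vector_derivative f' v) (at v)"
      "(f' has_vector_derivative of_real (\<alpha> v) * f' v + of_real (\<beta> v) * f v) (at v)"
    using assms unfolding second_order_equation_def by blast+
  from has_vector_derivative_cnj[OF d(1)]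
  show "((\<lambda>v. cnj (f v)) has_vector_derivative cnj (f' v)) (at v)" .
  from has_vector_derivative_cnj[OF d(2)]
  show "((\<lambda>v. cnj (f' v)) has_vector_derivative
      of_real (\<alpha> v) * cnj (f' v) + of_real (\<beta> v) * cnj (f v)) (at v)" by simp
qed

section \<open>Moduli of the connection coefficients\<close>

lemma complex_of_real_cosh: "complex_of_real (cosh x) = (exp (of_real x) + inverse (exp (of_real x))) / 2"
  by (simp add: cosh_field_def exp_minus exp_of_real)

lemma complex_of_real_sinh: "complex_of_real (sinh x) = (exp (of_real x) - inverse (exp (of_real x))) / 2"
  by (simp add: sinh_field_def exp_minus exp_of_real)

text \<open>On the line Re z = 1/2 the reflection of z to 1 - z is complex conjugation, so the
  reflection formula computes the squared modulus.\<close>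

lemma norm_Gamma_half:
  "(cmod (Gamma (1 / 2 + \<i> * of_real y)))\<^sup>2 = pi / cosh (pi * y)"
proof -
  let ?z = "1 / 2 + \<i> * complex_of_real y"
  have "1 - ?z = cnj ?z" by (simp add: complex_eq_iff)
  then have "Gamma ?z * cnj (Gamma ?z) = of_real pi / sin (of_real pi * ?z)"
    using Gamma_reflection_complex[of ?z] by (simp add: cnj_Gamma)
  also have "of_real pi * ?z = of_real (pi / 2) + \<i> * of_real (pi * y)"
    by (simp add: algebra_simps)
  also have "sin \<dots> = of_real (cosh (pi * y))"
    unfolding sin_add cos_i_times complex_of_real_cosh [symmetric] sin_of_real cos_of_real by simp
  finally have "complex_of_real ((cmod (Gamma ?z))\<^sup>2) = of_real (pi / cosh (pi * y))"
    by (simp add: complex_norm_square del: of_real_power)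
  then show ?thesis by (simp only: of_real_eq_iff)
qed

text \<open>For imaginary z one has 1 - z = 1 + cnj z, so the functional equation gives Gamma (1 -
  z) = - z * cnj (Gamma z), and the reflection formula again becomes a squared modulus.\<close>

lemma norm_Gamma_ii:
  assumes "y \<noteq> 0"
  shows "(cmod (Gamma (\<i> * of_real y)))\<^sup>2 = pi / (y * sinh (pi * y))"
    and "(cmod (Gamma (1 - \<i> * of_real y)))\<^sup>2 = pi * y / sinh (pi * y)"
proof -
  let ?z = "\<i> * complex_of_real y"
  have "cnj ?z \<notin> \<int>\<^sub>\<le>\<^sub>0" using assms by (auto elim!: nonpos_Ints_cases simp: complex_eq_iff)
  from Gamma_plus1[OF this] have plus1: "Gamma (1 - ?z) = - ?z * cnj (Gamma ?z)"
    by (simp add: cnj_Gamma add.commute)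
  have "sin (of_real pi * ?z) = \<i> * of_real (sinh (pi * y))"
  proof -
    have "of_real pi * ?z = \<i> * of_real (pi * y)" by simp
    then show ?thesis by (simp only: sin_i_times complex_of_real_sinh)
  qed
  then have "- ?z * (Gamma ?z * cnj (Gamma ?z)) = of_real pi / (\<i> * of_real (sinh (pi * y)))"
    using Gamma_reflection_complex[of ?z] unfolding plus1 by (simp add: mult_ac)
  then have "Gamma ?z * cnj (Gamma ?z) = of_real (pi / (y * sinh (pi * y)))"
    using assms by (simp add: field_simps)
  then have "complex_of_real ((cmod (Gamma ?z))\<^sup>2) = of_real (pi / (y * sinh (pi * y)))"
    by (simp only: complex_norm_square)
  then show 1: "(cmod (Gamma ?z))\<^sup>2 = pi / (y * sinh (pi * y))"
    by (simp only: of_real_eq_iff)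
  have "(cmod (Gamma (1 - ?z)))\<^sup>2 = y\<^sup>2 * (cmod (Gamma ?z))\<^sup>2"
    unfolding plus1 norm_mult power_mult_distrib by (simp add: norm_mult)
  then show "(cmod (Gamma (1 - ?z)))\<^sup>2 = pi * y / sinh (pi * y)"
    unfolding 1 using assms by (simp add: power2_eq_square)
qed

text \<open>This is why the two sectors agree. With h = 1/2 + i y/2 the scalar parameters are h, h
  and the shear parameters h - 1, h + 1; the functional equation changes the product by h/(h - 1),
  which has modulus 1 because Re h = 1/2.\<close>

lemma norm_Gamma_param:
  "(cmod (Gamma (param_a X (\<i> * of_real y)) * Gamma (param_b X (\<i> * of_real y))))\<^sup>2
     = (pi / cosh (pi / 2 * y))\<^sup>2"
proof -
  let ?h = "1 / 2 + \<i> * complex_of_real (y / 2)"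
  have half: "(cmod (Gamma ?h))\<^sup>2 = pi / cosh (pi / 2 * y)"
    using norm_Gamma_half[of "y / 2"] by simp
  have "cmod (Gamma (param_a X (\<i> * of_real y)) * Gamma (param_b X (\<i> * of_real y))) = (cmod (Gamma ?h))\<^sup>2"
  proof (cases X)
    case Scalar
    have "param_a X (\<i> * of_real y) = ?h" "param_b X (\<i> * of_real y) = ?h"
      by (simp_all add: Scalar param_a_def param_b_def add_divide_distrib)
    then show ?thesis by (simp add: norm_mult power2_eq_square)
  next
    case Shear
    have a: "param_a X (\<i> * of_real y) = ?h - 1" and b: "param_b X (\<i> * of_real y) = ?h + 1"
      by (simp_all add: Shear param_a_def param_b_def field_simps)
    have nz: "?h - 1 \<notin> \<int>\<^sub>\<le>\<^sub>0" "?h \<notin> \<int>\<^sub>\<le>\<^sub>0"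
    proof -
      have "- 1 / 2 \<noteq> real_of_int n" "1 / 2 \<noteq> real_of_int n" for n
      proof -
        have "real_of_int (2 * n) \<noteq> real_of_int (- 1)" "real_of_int (2 * n) \<noteq> real_of_int 1"
          unfolding of_int_eq_iff by presburger+
        then show "- 1 / 2 \<noteq> real_of_int n" "1 / 2 \<noteq> real_of_int n" by auto
      qed
      then show "?h - 1 \<notin> \<int>\<^sub>\<le>\<^sub>0" "?h \<notin> \<int>\<^sub>\<le>\<^sub>0"
        by (auto elim!: nonpos_Ints_cases simp: complex_eq_iff)
    qed
    have "Gamma ?h = (?h - 1) * Gamma (?h - 1)" "Gamma (?h + 1) = ?h * Gamma ?h"
      using Gamma_plus1[OF nz(1)] Gamma_plus1[OF nz(2)] by simp_all
    moreover have "cmod (?h - 1) = cmod ?h" by (simp add: cmod_def)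
    moreover have "?h - 1 \<noteq> 0" "?h \<noteq> 0" by (simp_all add: complex_eq_iff)
    ultimately show ?thesis unfolding a b
      by (simp add: norm_mult power2_eq_square mult_ac)
  qed
  then show ?thesis using half by (simp only:)
qed

section \<open>The connection coefficients as Gamma quotients, and their symmetries\<close>

lemma C01_eq_Gamma:
  fixes w q :: real and X :: sector
  defines "z \<equiv> \<i> * of_real (wavenumber w q - w)"
  shows "C01 X w q = Gamma (1 - \<i> * of_real w) * Gamma (\<i> * of_real (wavenumber w q))
     / (Gamma (param_a X z) * Gamma (param_b X z))"
proof -
  have "1 - hyp_c w q + hyp_a X w q + hyp_b X w q = 1 - \<i> * of_real w"
    "hyp_c w q - 1 = \<i> * of_real (wavenumber w q)"
    "hyp_a X w q = param_a X z" "hyp_b X w q = param_b X z"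
    by (cases X; simp add: hyp_c_def hyp_s_def param_a_def param_b_def z_def field_simps)+
  then show ?thesis by (simp only: C01_def conn_01_def)
qed

text \<open>This is the quotient for \<open>C01\<close> with the wavenumber negated, hence the
  explicit amplitude that \<open>jost_at_infinity\<close> delivers at - k.\<close>

lemma C00_eq_Gamma:
  fixes w q :: real and X :: sector
  defines "z \<equiv> \<i> * of_real (- wavenumber w q - w)"
  shows "C00 X w q = Gamma (1 - \<i> * of_real w) * Gamma (\<i> * of_real (- wavenumber w q))
     / (Gamma (param_a X z) * Gamma (param_b X z))"
proof -
  have "1 - hyp_c w q + hyp_a X w q + hyp_b X w q = 1 - \<i> * of_real w"
    "1 - hyp_c w q = \<i> * of_real (- wavenumber w q)"
    "1 - hyp_c w q + hyp_a X w q = param_a X z" "1 - hyp_c w q + hyp_b X w q = param_b X z"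
    by (cases X; simp add: hyp_c_def hyp_s_def param_a_def param_b_def z_def field_simps)+
  then show ?thesis by (simp add: C00_def conn_00_def mult.commute)
qed

lemma wavenumber_minus [simp]: "wavenumber (- w) q = wavenumber w q"
  by (simp add: wavenumber_def)

text \<open>Since a + b - c = - i w, one has c - b = a + i w, which is \<open>hyp_a\<close> at - w,
  and likewise c - a is \<open>hyp_b\<close> at - w. Subtracting s gives the same correspondence for
  \<open>C10\<close> and \<open>C00\<close>.\<close>

lemma C11_eq_C01_minus: "C11 X w q = C01 X (- w) q"
proof -
  define z where "z = \<i> * complex_of_real (wavenumber (- w) q - (- w))"
  have "1 + hyp_c w q - hyp_a X w q - hyp_b X w q = 1 - \<i> * of_real (- w)"
    "hyp_c w q - 1 = \<i> * of_real (wavenumber (- w) q)"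
    "hyp_c w q - hyp_b X w q = param_a X z" "hyp_c w q - hyp_a X w q = param_b X z"
    by (cases X; simp add: hyp_c_def hyp_s_def param_a_def param_b_def z_def field_simps)+
  then show ?thesis by (simp only: C11_def conn_11_def C01_eq_Gamma z_def [symmetric])
qed

lemma C10_eq_C00_minus: "C10 X w q = C00 X (- w) q"
proof -
  define z where "z = \<i> * complex_of_real (- wavenumber (- w) q - (- w))"
  have "1 + hyp_c w q - hyp_a X w q - hyp_b X w q = 1 - \<i> * of_real (- w)"
    "1 - hyp_c w q = \<i> * of_real (- wavenumber (- w) q)"
    "1 - hyp_b X w q = param_a X z" "1 - hyp_a X w q = param_b X z"
    by (cases X; simp add: hyp_c_def hyp_s_def param_a_def param_b_def z_def field_simps)+
  then show ?thesis
    by (simp only: C10_def conn_10_def C00_eq_Gamma z_def [symmetric] mult.commute)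
qed

lemma norm_C:
  fixes w q :: real and X :: sector
  defines "k \<equiv> wavenumber w q"
  assumes "w \<noteq> 0" "k \<noteq> 0"
  shows "(cmod (C00 X w q))\<^sup>2 = w * (cosh (pi / 2 * (k + w)))\<^sup>2 / (k * sinh (pi * w) * sinh (pi * k))"
    and "(cmod (C01 X w q))\<^sup>2 = w * (cosh (pi / 2 * (k - w)))\<^sup>2 / (k * sinh (pi * w) * sinh (pi * k))"
proof -
  have C00: "(cmod (C00 X w q))\<^sup>2 = (pi * w / sinh (pi * w)) * (pi / (- k * sinh (pi * - k))) / (pi / cosh (pi / 2 * (- k - w)))\<^sup>2"
    unfolding C00_eq_Gamma norm_divide power_divide norm_Gamma_param k_def [symmetric]
    unfolding norm_mult power_mult_distrib using assms
    by (subst norm_Gamma_ii, simp)+ simp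
  have cosh: "cosh (pi / 2 * (- k - w)) = cosh (pi / 2 * (k + w))"
    using cosh_minus[of "pi / 2 * (k + w)"] by (simp add: algebra_simps minus_divide_left del: cosh_minus)
  show "(cmod (C00 X w q))\<^sup>2 = w * (cosh (pi / 2 * (k + w)))\<^sup>2 / (k * sinh (pi * w) * sinh (pi * k))"
    unfolding C00 cosh by (simp add: power_divide field_simps power2_eq_square)
  have C01: "(cmod (C01 X w q))\<^sup>2 = (pi * w / sinh (pi * w)) * (pi / (k * sinh (pi * k))) / (pi / cosh (pi / 2 * (k - w)))\<^sup>2"
    unfolding C01_eq_Gamma norm_divide power_divide norm_Gamma_param k_def [symmetric]
    unfolding norm_mult power_mult_distrib using assms
    by (subst norm_Gamma_ii, simp)+ simp
  show "(cmod (C01 X w q))\<^sup>2 = w * (cosh (pi / 2 * (k - w)))\<^sup>2 / (k * sinh (pi * w) * sinh (pi * k))"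
    unfolding C01 by (simp add: power_divide field_simps power2_eq_square)
qed

text \<open>With x = pi/2 (k + w) and y = pi/2 (k - w) this gives T = 1 - R from the explicit
  formulas, in place of an argument by current conservation.\<close>

lemma cosh_squared_diff:
  fixes x y :: real
  shows "(cosh x)\<^sup>2 - (cosh y)\<^sup>2 = sinh (x + y) * sinh (x - y)"
proof -
  have "sinh (x + y) * sinh (x - y) = (sinh x)\<^sup>2 * (cosh y)\<^sup>2 - (cosh x)\<^sup>2 * (sinh y)\<^sup>2"
    by (simp add: sinh_add sinh_diff algebra_simps power2_eq_square)
  then show ?thesis by (simp add: sinh_square_eq algebra_simps)
qed

section \<open>Scattering\<close>

lemma current_plane_wave: "current (plane_wave A p) v = p * (cmod A)\<^sup>2"
proof -
  have "((\<lambda>v. p * v / 2) has_real_derivative p / 2) (at v)"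
    by (auto intro!: derivative_eq_intros)
  from has_vector_derivative_mult_right[OF has_vector_derivative_exp_ii[OF this], of A]
  have "(plane_wave A p has_vector_derivative \<i> * of_real (p / 2) * plane_wave A p v) (at v)"
    by (simp add: plane_wave_def[abs_def] mult_ac)
  then have d: "vector_derivative (plane_wave A p) (at v) = \<i> * of_real (p / 2) * plane_wave A p v"
    by (rule vector_derivative_at)
  have prod: "cnj (plane_wave A p v) * (\<i> * of_real (p / 2) * plane_wave A p v)
     = \<i> * of_real (p / 2) * of_real ((cmod (plane_wave A p v))\<^sup>2)"
    unfolding complex_norm_square by (simp add: mult_ac)
  show ?thesis unfolding current_def d prod by simp
qed

lemma current_at_infinity_plane_wave: "current_at_infinity (plane_wave A p) = p * (cmod A)\<^sup>2"
  unfolding current_at_infinity_def current_plane_wave[abs_def]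
  by (intro tendsto_Lim tendsto_const) (simp add: trivial_limit_at_bot_linorder)

lemma wavenumber_pos:
  assumes "\<bar>w\<bar> > sqrt (q\<^sup>2 + 1)"
  shows "wavenumber w q > 0" "(wavenumber w q)\<^sup>2 = w\<^sup>2 - q\<^sup>2 - 1" "w \<noteq> 0"
proof -
  have "sqrt (q\<^sup>2 + 1) < sqrt (w\<^sup>2)" using assms by simp
  then have "w\<^sup>2 - q\<^sup>2 - 1 > 0" by (simp only: real_sqrt_less_iff)
  then show "wavenumber w q > 0" "(wavenumber w q)\<^sup>2 = w\<^sup>2 - q\<^sup>2 - 1" by (simp_all add: wavenumber_def)
  have "sqrt (q\<^sup>2 + 1) \<ge> 0" by simp
  then show "w \<noteq> 0" using assms by linarith
qed

lemma tendsto_of_plane_wave_mult: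
  assumes "((\<lambda>v. exp (- \<i> * of_real (w * v / 2)) * f v) \<longlongrightarrow> A) F"
  shows "((\<lambda>v. f v - plane_wave A w v) \<longlongrightarrow> 0) F"
proof (rule tendsto_0_le[where f = "\<lambda>v. exp (- \<i> * of_real (w * v / 2)) * f v - A" and K = 1])
  show "((\<lambda>v. exp (- \<i> * of_real (w * v / 2)) * f v - A) \<longlongrightarrow> 0) F"
    using tendsto_diff[OF assms tendsto_const, of A] by simp
  have "norm (f v - plane_wave A w v) = norm (exp (- \<i> * of_real (w * v / 2)) * f v - A)" for v
  proof -
    have "plane_wave 1 w v * exp (- \<i> * of_real (w * v / 2)) = 1"
      by (simp add: plane_wave_def flip: exp_add)
    moreover have "plane_wave 1 w v * (exp (- \<i> * of_real (w * v / 2)) * f v - A)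
        = plane_wave 1 w v * exp (- \<i> * of_real (w * v / 2)) * f v - plane_wave A w v"
      by (simp add: plane_wave_def right_diff_distrib)
    ultimately have "f v - plane_wave A w v = plane_wave 1 w v * (exp (- \<i> * of_real (w * v / 2)) * f v - A)"
      by (simp only: mult_1)
    then show ?thesis by (simp only: norm_mult norm_plane_wave) simp
  qed
  then show "\<forall>\<^sub>F v in F. norm (f v - plane_wave A w v) \<le> norm (exp (- \<i> * of_real (w * v / 2)) * f v - A) * 1"
    by simp
qed

text \<open>Wronskians with the conjugate and currents are insensitive to a common phase, so they
  can be evaluated from the limits in \<open>jost_schroedinger\<close>.\<close>

lemma cnj_mult_phase_cancel:
  "cnj (exp (- \<i> * of_real x) * f) * (exp (- \<i> * of_real x) * g) = cnj f * g"
proof -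
  have "cnj (e * f) * (e * g) = cnj e * e * (cnj f * g)" for e
    by (simp add: mult_ac)
  moreover have "cnj (exp (- \<i> * of_real x)) * exp (- \<i> * of_real x) = 1"
    by (simp add: exp_cnj flip: exp_add)
  ultimately show ?thesis by (simp only: mult_1)
qed

text \<open>The Jost function f and its conjugate have Wronskian i w, which is nonzero, so they span
  all solutions. The coefficients of d in this basis are constant Wronskians, and a combination of
  the two horizon waves tends to 0 only if both coefficients vanish.\<close>

lemma schroedinger_vanishing_at_horizon:
  assumes w: "\<bar>w\<bar> > sqrt (q\<^sup>2 + 1)" and d: "schroedinger X w q d d'" and lim: "(d \<longlongrightarrow> 0) at_top"
  shows "d v = 0"
proof -
  note k = wavenumber_pos[OF w]
  define f where "f = jost X w (wavenumber w q)"
  obtain f' where f: "schroedinger X w q f f'"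
    and f_lim: "((\<lambda>v. exp (- \<i> * of_real (w * v / 2)) * f v) \<longlongrightarrow> 1) at_top"
    and f'_lim: "((\<lambda>v. exp (- \<i> * of_real (w * v / 2)) * f' v) \<longlongrightarrow> \<i> * of_real w / 2) at_top"
    using jost_schroedinger[of "wavenumber w q" w q X] k unfolding f_def by auto
  note g = second_order_equation_cnj[OF f]
  obtain c where c: "\<And>v. cnj (f v) * f' v - cnj (f' v) * f v = c"
    using wronskian_constant[OF g f] by blast
  have "((\<lambda>v. cnj (exp (- \<i> * of_real (w * v / 2)) * f v) * (exp (- \<i> * of_real (w * v / 2)) * f' v)
      - cnj (exp (- \<i> * of_real (w * v / 2)) * f' v) * (exp (- \<i> * of_real (w * v / 2)) * f v))
      \<longlongrightarrow> cnj 1 * (\<i> * of_real w / 2) - cnj (\<i> * of_real w / 2) * 1) at_top"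
    by (intro tendsto_intros f_lim f'_lim)
  then have "((\<lambda>v::real. c) \<longlongrightarrow> \<i> * of_real w) at_top"
    unfolding cnj_mult_phase_cancel c by simp
  then have c_eq: "c = \<i> * of_real w" by (simp add: tendsto_const_iff)
  obtain c1 where c1: "\<And>v. d v * f' v - d' v * f v = c1" using wronskian_constant[OF d f] by blast
  obtain c2 where c2: "\<And>v. d v * cnj (f' v) - d' v * cnj (f v) = c2" using wronskian_constant[OF d g] by blast
  \<comment> \<open>Cramer's rule: eliminating the derivative of d between the two Wronskians
    \<open>c1\<close> and \<open>c2\<close> leaves d times the Wronskian c.\<close>
  have d_eq: "\<i> * of_real w * d v = c1 * cnj (f v) - c2 * f v" for v
    unfolding c_eq [symmetric] c[of v, symmetric] c1[of v, symmetric] c2[of v, symmetric]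
    by (simp add: algebra_simps)
  have "((\<lambda>v. f v - plane_wave 1 w v) \<longlongrightarrow> 0) at_top"
    by (rule tendsto_of_plane_wave_mult[OF f_lim])
  then have "((\<lambda>v. c1 * cnj (f v - plane_wave 1 w v) - c2 * (f v - plane_wave 1 w v) - \<i> * of_real w * d v)
      \<longlongrightarrow> c1 * cnj 0 - c2 * 0 - \<i> * of_real w * 0) at_top"
    by (intro tendsto_intros lim)
  moreover have "c1 * cnj (f v - plane_wave 1 w v) - c2 * (f v - plane_wave 1 w v) - \<i> * of_real w * d v
      = plane_wave c2 w v + plane_wave (- c1) (- w) v" for v
    unfolding d_eq by (simp add: plane_wave_def exp_cnj algebra_simps)
  ultimately have "((\<lambda>v. plane_wave c2 w v + plane_wave (- c1) (- w) v) \<longlongrightarrow> 0) at_top"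
    by simp
  from plane_waves_tendsto_0[OF k(3) _ this] have "c1 = 0" "c2 = 0" by simp_all
  then show ?thesis using d_eq[of v] k(3) by simp
qed

lemma schroedinger_unique:
  assumes w: "\<bar>w\<bar> > sqrt (q\<^sup>2 + 1)"
    and "schroedinger X w q f f'" "((\<lambda>v. f v - plane_wave A w v) \<longlongrightarrow> 0) at_top"
    and "schroedinger X w q g g'" "((\<lambda>v. g v - plane_wave A w v) \<longlongrightarrow> 0) at_top"
  shows "f = g"
proof
  fix v
  have "schroedinger X w q (\<lambda>v. f v - g v) (\<lambda>v. f' v - g' v)"
    unfolding second_order_equation_def
  proof (intro allI conjI)
    fix v
    have "(f has_vector_derivative f' v) (at v)" "(g has_vector_derivative g' v) (at v)"
      and f'g': "(f' has_vector_derivative of_real 0 * f' v + of_real (potential X q (radius v) - w\<^sup>2 / 4) * f v) (at v)"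
      "(g' has_vector_derivative of_real 0 * g' v + of_real (potential X q (radius v) - w\<^sup>2 / 4) * g v) (at v)"
      using assms(2,4) unfolding second_order_equation_def by blast+
    then show "((\<lambda>v. f v - g v) has_vector_derivative f' v - g' v) (at v)"
      by (intro has_vector_derivative_diff)
    show "((\<lambda>v. f' v - g' v) has_vector_derivative of_real 0 * (f' v - g' v)
        + of_real (potential X q (radius v) - w\<^sup>2 / 4) * (f v - g v)) (at v)"
      by (rule has_vector_derivative_eq_rhs[OF has_vector_derivative_diff[OF f'g']])
         (simp only: of_real_0 mult_zero_left diff_self add_0_left right_diff_distrib)
  qed
  moreover have "((\<lambda>v. f v - g v) \<longlongrightarrow> 0) at_top"
    using tendsto_diff[OF assms(3,5)] by simp
  ultimately have "f v - g v = 0" by (rule schroedinger_vanishing_at_horizon[OF w])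
  then show "f v = g v" by simp
qed

section \<open>The absorption process and its time reversal\<close>

lemma jost_absorption_solution:
  assumes w: "\<bar>w\<bar> > sqrt (q\<^sup>2 + 1)"
  shows "absorption_solution X w q (jost X w (wavenumber w q)) (C00 X w q) (C01 X w q)"
proof -
  define k where "k = wavenumber w q"
  note k = wavenumber_pos[OF w, folded k_def]
  have hor: "\<exists>\<psi>'. schroedinger X w q (jost X w l) \<psi>' \<and> ((\<lambda>v. jost X w l v - plane_wave 1 w v) \<longlongrightarrow> 0) at_top"
    if "l\<^sup>2 = k\<^sup>2" for l
  proof -
    have "l \<noteq> 0" using that k(1) by auto
    then show ?thesis
      using jost_schroedinger[of l w q X] that k(2) tendsto_of_plane_wave_mult by metis
  qed
  have "jost X w k = jost X w (- k)"
    using schroedinger_unique[OF w] hor[of k] hor[of "- k"] by auto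
  moreover obtain A where A: "((\<lambda>v. jost X w k v - (plane_wave A k v + plane_wave (C01 X w q) (- k) v)) \<longlongrightarrow> 0) at_bot"
    using jost_at_infinity[of k X w] k(1) unfolding C01_eq_Gamma k_def by auto
  moreover obtain B where "((\<lambda>v. jost X w (- k) v - (plane_wave B (- k) v + plane_wave (C00 X w q) k v)) \<longlongrightarrow> 0) at_bot"
    using jost_at_infinity[of "- k" X w] k(1) unfolding C00_eq_Gamma k_def by auto
  \<comment> \<open>The first expansion has its unknown amplitude on the wave with momentum k, the
    second on the one with - k. They describe the same function, so uniqueness of plane-wave
    amplitudes resolves A.\<close>
  ultimately have "A = C00 X w q"
    using plane_waves_unique[of k at_bot "jost X w k" A "C01 X w q" "C00 X w q" B] k(1)
    by (simp add: add.commute)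
  then show ?thesis
    using A hor[of k] mode_iff_schroedinger[OF k(3)]
    unfolding absorption_solution_def k_def by blast
qed

lemma absorption_solution_unique:
  assumes w: "\<bar>w\<bar> > sqrt (q\<^sup>2 + 1)" and \<psi>: "absorption_solution X w q \<psi> A B"
  shows "\<psi> = jost X w (wavenumber w q)" "A = C00 X w q" "B = C01 X w q"
proof -
  note k = wavenumber_pos[OF w]
  note J = jost_absorption_solution[OF w, of X]
  show eq: "\<psi> = jost X w (wavenumber w q)"
    using schroedinger_unique[OF w] \<psi> J
    unfolding absorption_solution_def mode_iff_schroedinger[OF k(3)] by blast
  show "A = C00 X w q" "B = C01 X w q"
    using plane_waves_unique[of "wavenumber w q" at_bot \<psi> A B "C00 X w q" "C01 X w q"] k(1) \<psi> J
    unfolding absorption_solution_def eq by auto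
qed

lemma current_at_horizon_jost:
  assumes w: "\<bar>w\<bar> > sqrt (q\<^sup>2 + 1)"
  shows "current_at_horizon (jost X w (wavenumber w q)) = w"
proof -
  note k = wavenumber_pos[OF w]
  define f where "f = jost X w (wavenumber w q)"
  obtain f' where f: "schroedinger X w q f f'"
    and f_lim: "((\<lambda>v. exp (- \<i> * of_real (w * v / 2)) * f v) \<longlongrightarrow> 1) at_top"
    and f'_lim: "((\<lambda>v. exp (- \<i> * of_real (w * v / 2)) * f' v) \<longlongrightarrow> \<i> * of_real w / 2) at_top"
    using jost_schroedinger[of "wavenumber w q" w q X] k unfolding f_def by auto
  have "vector_derivative f (at v) = f' v" for v
    using f by (intro vector_derivative_at) (simp add: second_order_equation_def)
  then have current: "current f = (\<lambda>v. 2 * Im (cnj (f v) * f' v))"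
    by (simp add: current_def fun_eq_iff)
  have "((\<lambda>v. 2 * Im (cnj (exp (- \<i> * of_real (w * v / 2)) * f v) * (exp (- \<i> * of_real (w * v / 2)) * f' v)))
      \<longlongrightarrow> 2 * Im (cnj 1 * (\<i> * of_real w / 2))) at_top"
    by (intro tendsto_intros f_lim f'_lim)
  then have "(current f \<longlongrightarrow> w) at_top"
    unfolding cnj_mult_phase_cancel current [symmetric] by simp
  then show ?thesis unfolding current_at_horizon_def f_def
    by (intro tendsto_Lim) (simp_all add: trivial_limit_at_top_linorder)
qed

text \<open>Formulated for either sign of w, so that both halves of the theorem are instances, at w
  and at - w.\<close>

lemma absorption_coefficients:
  assumes w: "\<bar>w\<bar> > sqrt (q\<^sup>2 + 1)"
  shows "(\<exists>!\<psi>. absorption_solution X w q \<psi> (C00 X w q) (C01 X w q)) \<and>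
        (\<forall>\<psi> A_in A_out. absorption_solution X w q \<psi> A_in A_out \<longrightarrow>
          A_in = C00 X w q \<and> A_out = C01 X w q \<and>
          (let k = sqrt (w\<^sup>2 - q\<^sup>2 - 1);
               R = reflection_coefficient (plane_wave A_in k) (plane_wave A_out (- k));
               T = transmission_coefficient (plane_wave A_in k) \<psi>
           in R = (cmod A_out)\<^sup>2 / (cmod A_in)\<^sup>2 \<and>
              R = (cosh (pi / 2 * (k - w)))\<^sup>2 / (cosh (pi / 2 * (k + w)))\<^sup>2 \<and>
              T = w / (k * (cmod A_in)\<^sup>2) \<and>
              T = 1 - R \<and>
              T = sinh (pi * w) * sinh (pi * k) / (cosh (pi / 2 * (k + w)))\<^sup>2))"
proof (intro conjI allI impI)
  show "\<exists>!\<psi>. absorption_solution X w q \<psi> (C00 X w q) (C01 X w q)"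
    using jost_absorption_solution[OF w] absorption_solution_unique(1)[OF w] by blast
  fix \<psi> A B assume *: "absorption_solution X w q \<psi> A B"
  note eq = absorption_solution_unique[OF w *]
  show "A = C00 X w q" "B = C01 X w q" by (fact eq)+
  define k where "k = wavenumber w q"
  note k = wavenumber_pos[OF w, folded k_def]
  define R T where "R = reflection_coefficient (plane_wave A k) (plane_wave B (- k))"
    and "T = transmission_coefficient (plane_wave A k) \<psi>"
  have R: "R = (cmod B)\<^sup>2 / (cmod A)\<^sup>2"
    using k(1) by (simp add: R_def reflection_coefficient_def current_at_infinity_plane_wave)
  have T: "T = w / (k * (cmod A)\<^sup>2)"
    by (simp add: T_def transmission_coefficient_def current_at_infinity_plane_wave eq(1)
        current_at_horizon_jost[OF w])
  have A: "(cmod A)\<^sup>2 = w * (cosh (pi / 2 * (k + w)))\<^sup>2 / (k * sinh (pi * w) * sinh (pi * k))"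
    and B: "(cmod B)\<^sup>2 = w * (cosh (pi / 2 * (k - w)))\<^sup>2 / (k * sinh (pi * w) * sinh (pi * k))"
    unfolding eq k_def using k(1,3) by (intro norm_C; simp add: k_def)+
  have nz: "sinh (pi * w) \<noteq> 0" "sinh (pi * k) \<noteq> 0" "k \<noteq> 0" "cosh (pi / 2 * (k + w)) \<noteq> 0"
    using k(1,3) by auto
  have R': "R = (cosh (pi / 2 * (k - w)))\<^sup>2 / (cosh (pi / 2 * (k + w)))\<^sup>2"
    unfolding R A B using nz k(3) by simp
  have T': "T = sinh (pi * w) * sinh (pi * k) / (cosh (pi / 2 * (k + w)))\<^sup>2"
    unfolding T A using nz k(3) by simp
  have diff: "(cosh (pi / 2 * (k + w)))\<^sup>2 - (cosh (pi / 2 * (k - w)))\<^sup>2 = sinh (pi * w) * sinh (pi * k)"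
    unfolding cosh_squared_diff by (simp add: field_simps)
  have "T = 1 - R"
    unfolding T' R' diff [symmetric] by (simp add: diff_divide_distrib)
  with R R' T T' show "let k = sqrt (w\<^sup>2 - q\<^sup>2 - 1);
               R = reflection_coefficient (plane_wave A k) (plane_wave B (- k));
               T = transmission_coefficient (plane_wave A k) \<psi>
           in R = (cmod B)\<^sup>2 / (cmod A)\<^sup>2 \<and>
              R = (cosh (pi / 2 * (k - w)))\<^sup>2 / (cosh (pi / 2 * (k + w)))\<^sup>2 \<and>
              T = w / (k * (cmod A)\<^sup>2) \<and>
              T = 1 - R \<and>
              T = sinh (pi * w) * sinh (pi * k) / (cosh (pi / 2 * (k + w)))\<^sup>2"
    unfolding Let_def R_def T_def k_def wavenumber_def by blast
qed

text \<open>The Schroedinger equation contains w only through w^2, so modes at w and - w coincide.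
  The wave with positive momentum at infinity is outgoing in one description and incoming in the
  other, which exchanges the amplitudes.\<close>

lemma reversed_absorption_solution_iff:
  assumes "w \<noteq> 0"
  shows "reversed_absorption_solution X w q \<psi> A_in A_out \<longleftrightarrow> absorption_solution X (- w) q \<psi> A_out A_in"
  using assms mode_iff_schroedinger[of w X q \<psi>] mode_iff_schroedinger[of "- w" X q \<psi>]
  by (simp add: reversed_absorption_solution_def absorption_solution_def)

theorem mainTheorem6:
  fixes w q :: real and X :: sector
  assumes "\<bar>w\<bar> > sqrt (q\<^sup>2 + 1)"
  shows
    "(w > sqrt (q\<^sup>2 + 1) \<longrightarrow>
        (\<exists>!\<psi>. absorption_solution X w q \<psi> (C00 X w q) (C01 X w q)) \<and>
        (\<forall>\<psi> A_in A_out. absorption_solution X w q \<psi> A_in A_out \<longrightarrow>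
          A_in = C00 X w q \<and> A_out = C01 X w q \<and>
          (let k = sqrt (w\<^sup>2 - q\<^sup>2 - 1);
               R = reflection_coefficient (plane_wave A_in k) (plane_wave A_out (- k));
               T = transmission_coefficient (plane_wave A_in k) \<psi>
           in R = (cmod A_out)\<^sup>2 / (cmod A_in)\<^sup>2 \<and>
              R = (cosh (pi / 2 * (k - w)))\<^sup>2 / (cosh (pi / 2 * (k + w)))\<^sup>2 \<and>
              T = w / (k * (cmod A_in)\<^sup>2) \<and>
              T = 1 - R \<and>
              T = sinh (pi * w) * sinh (pi * k) / (cosh (pi / 2 * (k + w)))\<^sup>2)))
     \<and>
     (w < - sqrt (q\<^sup>2 + 1) \<longrightarrow>
        (\<exists>!\<psi>. reversed_absorption_solution X w q \<psi> (C11 X w q) (C10 X w q)) \<and>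
        (\<forall>\<psi> A_in A_out. reversed_absorption_solution X w q \<psi> A_in A_out \<longrightarrow>
          A_in = C11 X w q \<and> A_out = C10 X w q \<and>
          (let k = sqrt (w\<^sup>2 - q\<^sup>2 - 1);
               R = reflection_coefficient (plane_wave A_out k) (plane_wave A_in (- k));
               T = transmission_coefficient (plane_wave A_out k) \<psi>
           in R = (cmod A_in)\<^sup>2 / (cmod A_out)\<^sup>2 \<and>
              R = (cosh (pi / 2 * (k + w)))\<^sup>2 / (cosh (pi / 2 * (k - w)))\<^sup>2 \<and>
              T = - w / (k * (cmod A_out)\<^sup>2) \<and>
              T = 1 - R \<and>
              T = - sinh (pi * w) * sinh (pi * k) / (cosh (pi / 2 * (k - w)))\<^sup>2)))"
proof (intro conjI[of "_ \<longrightarrow> _"] impI)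
  show "(\<exists>!\<psi>. absorption_solution X w q \<psi> (C00 X w q) (C01 X w q)) \<and>
        (\<forall>\<psi> A_in A_out. absorption_solution X w q \<psi> A_in A_out \<longrightarrow>
          A_in = C00 X w q \<and> A_out = C01 X w q \<and>
          (let k = sqrt (w\<^sup>2 - q\<^sup>2 - 1);
               R = reflection_coefficient (plane_wave A_in k) (plane_wave A_out (- k));
               T = transmission_coefficient (plane_wave A_in k) \<psi>
           in R = (cmod A_out)\<^sup>2 / (cmod A_in)\<^sup>2 \<and>
              R = (cosh (pi / 2 * (k - w)))\<^sup>2 / (cosh (pi / 2 * (k + w)))\<^sup>2 \<and>
              T = w / (k * (cmod A_in)\<^sup>2) \<and>
              T = 1 - R \<and>
              T = sinh (pi * w) * sinh (pi * k) / (cosh (pi / 2 * (k + w)))\<^sup>2))"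
    by (rule absorption_coefficients[OF assms])
next
  note w = wavenumber_pos(3)[OF assms]
  have "\<bar>- w\<bar> > sqrt (q\<^sup>2 + 1)" using assms by simp
  note minus = absorption_coefficients[OF this, of X]
  show "(\<exists>!\<psi>. reversed_absorption_solution X w q \<psi> (C11 X w q) (C10 X w q)) \<and>
        (\<forall>\<psi> A_in A_out. reversed_absorption_solution X w q \<psi> A_in A_out \<longrightarrow>
          A_in = C11 X w q \<and> A_out = C10 X w q \<and>
          (let k = sqrt (w\<^sup>2 - q\<^sup>2 - 1);
               R = reflection_coefficient (plane_wave A_out k) (plane_wave A_in (- k));
               T = transmission_coefficient (plane_wave A_out k) \<psi>
           in R = (cmod A_in)\<^sup>2 / (cmod A_out)\<^sup>2 \<and>
              R = (cosh (pi / 2 * (k + w)))\<^sup>2 / (cosh (pi / 2 * (k - w)))\<^sup>2 \<and>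
              T = - w / (k * (cmod A_out)\<^sup>2) \<and>
              T = 1 - R \<and>
              T = - sinh (pi * w) * sinh (pi * k) / (cosh (pi / 2 * (k - w)))\<^sup>2))"
    unfolding reversed_absorption_solution_iff[OF w] C10_eq_C00_minus C11_eq_C01_minus
  proof (rule conjI[OF conjunct1[OF minus]], intro allI impI)
    fix \<psi> A_in A_out
    assume "absorption_solution X (- w) q \<psi> A_out A_in"
    with conjunct2[OF minus] have "A_out = C00 X (- w) q \<and> A_in = C01 X (- w) q \<and>
          (let k = sqrt ((- w)\<^sup>2 - q\<^sup>2 - 1);
               R = reflection_coefficient (plane_wave A_out k) (plane_wave A_in (- k));
               T = transmission_coefficient (plane_wave A_out k) \<psi>
           in R = (cmod A_in)\<^sup>2 / (cmod A_out)\<^sup>2 \<and>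
              R = (cosh (pi / 2 * (k - - w)))\<^sup>2 / (cosh (pi / 2 * (k + - w)))\<^sup>2 \<and>
              T = - w / (k * (cmod A_out)\<^sup>2) \<and>
              T = 1 - R \<and>
              T = sinh (pi * - w) * sinh (pi * k) / (cosh (pi / 2 * (k + - w)))\<^sup>2)"
      by blast
    then show "A_in = C01 X (- w) q \<and> A_out = C00 X (- w) q \<and>
          (let k = sqrt (w\<^sup>2 - q\<^sup>2 - 1);
               R = reflection_coefficient (plane_wave A_out k) (plane_wave A_in (- k));
               T = transmission_coefficient (plane_wave A_out k) \<psi>
           in R = (cmod A_in)\<^sup>2 / (cmod A_out)\<^sup>2 \<and>
              R = (cosh (pi / 2 * (k + w)))\<^sup>2 / (cosh (pi / 2 * (k - w)))\<^sup>2 \<and>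
              T = - w / (k * (cmod A_out)\<^sup>2) \<and>
              T = 1 - R \<and>
              T = - sinh (pi * w) * sinh (pi * k) / (cosh (pi / 2 * (k - w)))\<^sup>2)"
      unfolding Let_def power2_minus diff_minus_eq_add add_uminus_conv_diff mult_minus_right sinh_minus
      by blast
  qed
qed

end
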